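(* Let $\mathcal{T}=(\tau_0,\dots,\tau_{j-1})$ be the tuple of sampling intervals (positive integers) of a periodic sampling schedule, and let $h=\sum_{\ell=0}^{j-1}\tau_\ell$ be its period. Then the optimal (minimal over all control policies $u_t=\mu_{u,t}(\mathcal{J}_t)$) value of the average cost $J_2=\lim_{T\to\infty}\frac1T\mathbb{E}\big[\sum_{t=0}^{T-1}\|z_t\|^2\big]$ is $$J_2=\operatorname{tr}(PW)+\frac1h\sum_{\ell=0}^{j-1}\beta(\tau_\ell),$$ where $\beta(1)=0$ and, for integers $p>1$, $$\beta(p)=\operatorname{tr}\Big(Z\sum_{s=1}^{p-1}Y(s)\Big),\qquad Y(s)=\sum_{r=0}^{s-1}A^rW(A^\top)^r,\ s\in\mathbb{N}.$$ Moreover, an optimal control policy minimizing $J_2$ is $u_k=K\hat x_{k|k}$, where $\hat x_{k+1|k}=A\hat x_{k|k}+Bu_k$, and $\hat x_{k|k}=x_k$ if $\sigma_k=1$, $\hat x_{k|k}=\hat x_{k|k-1}$ if $\sigma_k=0$.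
   Context: System: $x_{t+1}=Ax_t+Bu_t+w_t$, $t\in\mathbb{N}_0$, with output $z_t=C_2x_t+D_{21}u_t$, where $x_t,w_t\in\mathbb{R}^{n_x}$, $u_t\in\mathbb{R}^{n_u}$, $C_2^\top D_{21}=0$, $Q:=C_2^\top C_2$, $R:=D_{21}^\top D_{21}>0$, $(A,B)$ controllable and $(A,C_2)$ observable. The initial state $x_0$ is fixed. The $w_t$ are independent, identically distributed, zero-mean random vectors with $\mathbb{E}[w_tw_t^\top]=W\ge 0$. Schedule: a tuple $(\tau_0,\dots,\tau_{j-1})$ of positive integers is extended periodically by $\tau_{\ell+j}=\tau_\ell$; the sampling times are $s_0=0$, $s_{\ell+1}=s_\ell+\tau_\ell$; $\sigma_t=1$ if $t$ is a sampling time and $\sigma_t=0$ otherwise. At time $t$ the controller knows $\mathcal{J}_t=\{x_r: 0\le r\le t,\ \sigma_r=1\}$, and a control policy is a sequence of functions $\mu_{u,t}$ with $u_t=\mu_{u,t}(\mathcal{J}_t)$ (so $u_t$ is updated at every time). Matrices: $P$ is the unique positive definite solution of $P=A^\top PA+Q-A^\top PB(R+B^\top PB)^{-1}B^\top PA$; $Z=A^\top PB(B^\top PB+R)^{-1}B^\top PA$; $K=-(B^\top PB+R)^{-1}B^\top PA$. *)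

theory Defs
  imports "HOL-Probability.Probability"
begin

section \<open>Matrices\<close>

text \<open>On \<open>real ^ 'n ^ 'n\<close> the operations \<open>*\<close> and \<open>^\<close> act componentwise, so powers
  with respect to the matrix product \<open>**\<close> are defined here.\<close>

primrec mat_pow :: "real ^ 'n ^ 'n \<Rightarrow> nat \<Rightarrow> real ^ 'n ^ 'n" where
  "mat_pow A 0 = mat 1"
| "mat_pow A (Suc r) = A ** mat_pow A r"

definition pos_semidef :: "real ^ 'n ^ 'n \<Rightarrow> bool" where
  "pos_semidef M \<longleftrightarrow> transpose M = M \<and> (\<forall>v. 0 \<le> v \<bullet> (M *v v))"

definition pos_def :: "real ^ 'n ^ 'n \<Rightarrow> bool" where
  "pos_def M \<longleftrightarrow> transpose M = M \<and> (\<forall>v. v \<noteq> 0 \<longrightarrow> 0 < v \<bullet> (M *v v))"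

text \<open>Kalman's rank conditions: the block matrix with block columns \<open>A\<^sup>i B\<close>, respectively with
  block rows \<open>C A\<^sup>i\<close>, for \<open>0 \<le> i < n\<close>, has rank \<open>n\<close>.\<close>

definition controllable :: "real ^ 'n ^ 'n \<Rightarrow> real ^ 'm ^ 'n \<Rightarrow> bool" where
  "controllable A B \<longleftrightarrow> span (\<Union>i<CARD('n). columns (mat_pow A i ** B)) = UNIV"

definition observable :: "real ^ 'n ^ 'n \<Rightarrow> real ^ 'n ^ 'p \<Rightarrow> bool" where
  "observable A C \<longleftrightarrow> span (\<Union>i<CARD('n). rows (C ** mat_pow A i)) = UNIV"

definition riccati_solution ::
    "real ^ 'n ^ 'n \<Rightarrow> real ^ 'm ^ 'n \<Rightarrow> real ^ 'n ^ 'n \<Rightarrow> real ^ 'm ^ 'm \<Rightarrow> real ^ 'n ^ 'n \<Rightarrow> bool" where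
  "riccati_solution A B Q R P \<longleftrightarrow>
     P = transpose A ** P ** A + Q
         - transpose A ** P ** B ** matrix_inv (R + transpose B ** P ** B) ** transpose B ** P ** A"

section \<open>Periodic sampling schedules\<close>

text \<open>The \<open>\<ell>\<close>-th sampling time, for the periodic extension of the tuple \<open>\<tau>\<close> of intervals.\<close>

primrec sampling_time :: "nat list \<Rightarrow> nat \<Rightarrow> nat" where
  "sampling_time \<tau> 0 = 0"
| "sampling_time \<tau> (Suc l) = sampling_time \<tau> l + \<tau> ! (l mod length \<tau>)"

definition sampled :: "nat list \<Rightarrow> nat \<Rightarrow> bool" where
  "sampled \<tau> t \<longleftrightarrow> (\<exists>l. sampling_time \<tau> l = t)"

definition known_times :: "nat list \<Rightarrow> nat \<Rightarrow> nat set" where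
  "known_times \<tau> t = {r. r \<le> t \<and> sampled \<tau> r}"

section \<open>Control policies and the closed loop\<close>

text \<open>The information available at time \<open>t\<close> is the family \<open>(x\<^sub>r)\<close> indexed by
  \<open>known_times \<tau> t\<close>, an element of a finite product space. A policy is a sequence of Borel
  functions of these families; measurability makes the inputs random variables.\<close>

definition control_policy ::
    "nat list \<Rightarrow> (nat \<Rightarrow> (nat \<Rightarrow> real ^ 'n) \<Rightarrow> real ^ 'm) \<Rightarrow> bool" where
  "control_policy \<tau> \<mu> \<longleftrightarrow>
     (\<forall>t. \<mu> t \<in> borel_measurable (Pi\<^sub>M (known_times \<tau> t) (\<lambda>_. borel)))"

lemma restrict_fundef_cong [fundef_cong]:
  "I = J \<Longrightarrow> (\<And>i. i \<in> J \<Longrightarrow> f i = g i) \<Longrightarrow> restrict f I = restrict g J"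
  by (auto simp: restrict_def)

text \<open>State at time \<open>t\<close> and input at time \<open>t\<close> under the policy \<open>\<mu>\<close>, for one realization \<open>v\<close> of
  the whole noise sequence.\<close>

function state ::
    "real ^ 'n ^ 'n \<Rightarrow> real ^ 'm ^ 'n \<Rightarrow> real ^ 'n \<Rightarrow> nat list \<Rightarrow>
     (nat \<Rightarrow> (nat \<Rightarrow> real ^ 'n) \<Rightarrow> real ^ 'm) \<Rightarrow> (nat \<Rightarrow> real ^ 'n) \<Rightarrow> nat \<Rightarrow> real ^ 'n" where
  "state A B x0 \<tau> \<mu> v 0 = x0"
| "state A B x0 \<tau> \<mu> v (Suc t) =
     A *v state A B x0 \<tau> \<mu> v t
     + B *v \<mu> t (\<lambda>r\<in>known_times \<tau> t. state A B x0 \<tau> \<mu> v r) + v t"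
  by pat_completeness auto
termination
  by (relation "Wellfounded.measure (\<lambda>(A, B, x0, \<tau>, \<mu>, v, t). t)") (auto simp: known_times_def)

definition control_input ::
    "real ^ 'n ^ 'n \<Rightarrow> real ^ 'm ^ 'n \<Rightarrow> real ^ 'n \<Rightarrow> nat list \<Rightarrow>
     (nat \<Rightarrow> (nat \<Rightarrow> real ^ 'n) \<Rightarrow> real ^ 'm) \<Rightarrow> (nat \<Rightarrow> real ^ 'n) \<Rightarrow> nat \<Rightarrow> real ^ 'm" where
  "control_input A B x0 \<tau> \<mu> v t = \<mu> t (\<lambda>r\<in>known_times \<tau> t. state A B x0 \<tau> \<mu> v r)"

definition system_output ::
    "real ^ 'n ^ 'n \<Rightarrow> real ^ 'm ^ 'n \<Rightarrow> real ^ 'n ^ 'p \<Rightarrow> real ^ 'm ^ 'p \<Rightarrow> real ^ 'n \<Rightarrow> nat list \<Rightarrow>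
     (nat \<Rightarrow> (nat \<Rightarrow> real ^ 'n) \<Rightarrow> real ^ 'm) \<Rightarrow> (nat \<Rightarrow> real ^ 'n) \<Rightarrow> nat \<Rightarrow> real ^ 'p" where
  "system_output A B C2 D21 x0 \<tau> \<mu> v t =
     C2 *v state A B x0 \<tau> \<mu> v t + D21 *v control_input A B x0 \<tau> \<mu> v t"

text \<open>The expectation is a nonnegative integral, with value \<open>\<infinity>\<close> for policies whose expected cost
  is infinite; the average is taken in \<open>ereal\<close>.\<close>

definition average_cost ::
    "'a measure \<Rightarrow> (nat \<Rightarrow> 'a \<Rightarrow> real ^ 'n) \<Rightarrow>
     real ^ 'n ^ 'n \<Rightarrow> real ^ 'm ^ 'n \<Rightarrow> real ^ 'n ^ 'p \<Rightarrow> real ^ 'm ^ 'p \<Rightarrow> real ^ 'n \<Rightarrow> nat list \<Rightarrow>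
     (nat \<Rightarrow> (nat \<Rightarrow> real ^ 'n) \<Rightarrow> real ^ 'm) \<Rightarrow> nat \<Rightarrow> ereal" where
  "average_cost M w A B C2 D21 x0 \<tau> \<mu> T =
     enn2ereal (\<integral>\<^sup>+ \<omega>. ennreal (\<Sum>t<T.
       (norm (system_output A B C2 D21 x0 \<tau> \<mu> (\<lambda>s. w s \<omega>) t))\<^sup>2) \<partial>M) / ereal (real T)"

text \<open>The limit defining the cost need not exist for every policy. An optimal policy with value
  \<open>J\<close> is one whose cost is the limit \<open>J\<close>, while no policy has a smaller lower limit; in particular
  no policy whose cost is a limit has a smaller cost.\<close>

definition optimal_policy ::
    "'a measure \<Rightarrow> (nat \<Rightarrow> 'a \<Rightarrow> real ^ 'n) \<Rightarrow>
     real ^ 'n ^ 'n \<Rightarrow> real ^ 'm ^ 'n \<Rightarrow> real ^ 'n ^ 'p \<Rightarrow> real ^ 'm ^ 'p \<Rightarrow> real ^ 'n \<Rightarrow> nat list \<Rightarrow>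
     (nat \<Rightarrow> (nat \<Rightarrow> real ^ 'n) \<Rightarrow> real ^ 'm) \<Rightarrow> real \<Rightarrow> bool" where
  "optimal_policy M w A B C2 D21 x0 \<tau> \<mu> J \<longleftrightarrow>
     control_policy \<tau> \<mu> \<and>
     average_cost M w A B C2 D21 x0 \<tau> \<mu> \<longlonglongrightarrow> ereal J \<and>
     (\<forall>\<nu>. control_policy \<tau> \<nu> \<longrightarrow> ereal J \<le> liminf (average_cost M w A B C2 D21 x0 \<tau> \<nu>))"

section \<open>The certainty-equivalent policy\<close>

text \<open>The estimates of the state at time \<open>k\<close> given the samples up to time \<open>k\<close>
  (\<open>filtered_state\<close>) and up to time \<open>k - 1\<close> (\<open>predicted_state\<close>), as functions of
  the sampled states \<open>y\<close>, with the input set to \<open>K\<close> times \<open>filtered_state\<close>. Since time 0 is always a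
  sampling time, the value of \<open>predicted_state\<close> at 0 is irrelevant.\<close>

function (sequential)
  filtered_state :: "real ^ 'n ^ 'n \<Rightarrow> real ^ 'm ^ 'n \<Rightarrow> real ^ 'n ^ 'm \<Rightarrow> nat list \<Rightarrow>
     (nat \<Rightarrow> real ^ 'n) \<Rightarrow> nat \<Rightarrow> real ^ 'n" and
  predicted_state :: "real ^ 'n ^ 'n \<Rightarrow> real ^ 'm ^ 'n \<Rightarrow> real ^ 'n ^ 'm \<Rightarrow> nat list \<Rightarrow>
     (nat \<Rightarrow> real ^ 'n) \<Rightarrow> nat \<Rightarrow> real ^ 'n" where
  "filtered_state A B K \<tau> y k =
     (if sampled \<tau> k then y k else predicted_state A B K \<tau> y k)"
| "predicted_state A B K \<tau> y 0 = 0"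
| "predicted_state A B K \<tau> y (Suc k) =
     A *v filtered_state A B K \<tau> y k + B *v (K *v filtered_state A B K \<tau> y k)"
  by pat_completeness auto
termination
  by (relation "Wellfounded.measure (\<lambda>a. case a of
        Inl (A, B, K, \<tau>, y, k) \<Rightarrow> 2 * k + 1 | Inr (A, B, K, \<tau>, y, k) \<Rightarrow> 2 * k)") auto

definition estimate_feedback ::
    "real ^ 'n ^ 'n \<Rightarrow> real ^ 'm ^ 'n \<Rightarrow> real ^ 'n ^ 'm \<Rightarrow> nat list \<Rightarrow>
     nat \<Rightarrow> (nat \<Rightarrow> real ^ 'n) \<Rightarrow> real ^ 'm" where
  "estimate_feedback A B K \<tau> k y = K *v filtered_state A B K \<tau> y k"

section \<open>The optimal value\<close>

definition noise_gramian :: "real ^ 'n ^ 'n \<Rightarrow> real ^ 'n ^ 'n \<Rightarrow> nat \<Rightarrow> real ^ 'n ^ 'n" where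
  "noise_gramian A W s = (\<Sum>r<s. mat_pow A r ** W ** mat_pow (transpose A) r)"

definition interval_cost ::
    "real ^ 'n ^ 'n \<Rightarrow> real ^ 'n ^ 'n \<Rightarrow> real ^ 'n ^ 'n \<Rightarrow> nat \<Rightarrow> real" where
  "interval_cost A W Z p =
     (if p > 1 then trace (Z ** (\<Sum>s=1..p-1. noise_gramian A W s)) else 0)"

end

theory Submission
  imports Defs
begin

text \<open>By the Riccati equation, the stage cost plus the increment of \<open>E[x\<^sup>T P x]\<close> equals
  \<open>tr (P W) + E[(u - K x)\<^sup>T S (u - K x)]\<close> with \<open>S = B\<^sup>T P B + R\<close>. Split the state into its estimate from the
  samples and an error that depends only on the noise since the last sample. The error is orthogonal to
  everything the controller knows and has covariance \<open>Y(t - s)\<close> at time \<open>t\<close> when \<open>s\<close> is the last sampling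
  time; as \<open>Z = K\<^sup>T S K\<close>, the second term is at least \<open>tr (Z Y(t - s))\<close>, with equality for the
  certainty-equivalent policy.
  It remains to control the terminal term \<open>E[x\<^sub>T\<^sup>T P x\<^sub>T]\<close>. By observability, \<open>E[x\<^sub>t\<^sup>T P x\<^sub>t]\<close> is bounded by a
  constant plus a multiple of the cost of the next \<open>n\<close> steps. For the certainty-equivalent policy this
  turns the cost identity into a contraction over \<open>n\<close> steps, so the term stays bounded; for an arbitrary
  policy, averaging the cost identity over \<open>N\<close> consecutive horizons loses only a factor \<open>1 + O(1/N)\<close>.\<close>

section \<open>Quadratic forms\<close>

lemma inner_transpose_mult: "x \<bullet> (transpose N *v y) = (N *v x) \<bullet> (y :: real ^ 'n)"
  for N :: "real ^ 'm ^ 'n"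
  by (metis dot_lmul_matrix inner_commute transpose_matrix_vector)

lemma inner_mult_vec_left: "(N *v x) \<bullet> y = x \<bullet> (transpose N *v y)" for N :: "real ^ 'k ^ 'l"
  by (simp add: inner_transpose_mult del: transpose_matrix_vector)

lemma trace_mult_eq_sum: "trace (N ** W) = (\<Sum>i\<in>UNIV. \<Sum>j\<in>UNIV. N $ i $ j * W $ j $ i)"
  for N W :: "real ^ 'n ^ 'n"
  by (simp add: trace_def matrix_matrix_mult_def)

lemma trace_zero_matrix [simp]: "trace (0 :: real ^ 'n ^ 'n) = 0"
  by (simp add: trace_def)

lemma trace_mult_sum: "trace (Z ** (\<Sum>s\<in>S. N s)) = (\<Sum>s\<in>S. trace (Z ** N s))"
  for Z :: "real ^ 'n ^ 'n"
proof (cases "finite S")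
  case True
  then show ?thesis
    by induction (simp_all add: matrix_add_ldistrib trace_add)
qed simp

lemma mat_pow_commute: "mat_pow N r ** N = N ** mat_pow N r" for N :: "real ^ 'k ^ 'k"
  by (induction r) (simp_all add: matrix_mul_assoc[symmetric])

lemma matrix_mult_sum_left: "N ** (\<Sum>s\<in>I. X s) = (\<Sum>s\<in>I. N ** X s)" for N :: "real ^ 'k ^ 'l"
  by (induction I rule: infinite_finite_induct) (simp_all add: matrix_add_ldistrib)

lemma matrix_mult_sum_right: "(\<Sum>s\<in>I. X s) ** N = (\<Sum>s\<in>I. X s ** N)" for N :: "real ^ 'k ^ 'l"
  by (induction I rule: infinite_finite_induct) (simp_all add: matrix_matrix_mult_def vec_eq_iff sum.distrib distrib_right)

text \<open>The covariance recursion of an unsampled step: the term \<open>r = 0\<close> is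
  \<open>W\<close>, and from the others one factor \<open>A\<close> is pulled out on the left and
  one \<open>transpose A\<close> on the right.\<close>

lemma noise_gramian_Suc: "noise_gramian A W (Suc s) = W + A ** noise_gramian A W s ** transpose A"
  unfolding noise_gramian_def sum.lessThan_Suc_shift matrix_mult_sum_left matrix_mult_sum_right
  by (simp add: matrix_mul_assoc[symmetric] mat_pow_commute)

lemma inner_mult_vec_eq_sum:
  "x \<bullet> (N *v y) = (\<Sum>i\<in>UNIV. \<Sum>j\<in>UNIV. N $ i $ j * (x $ i * y $ j))" for N :: "real ^ 'm ^ 'n"
  by (simp add: inner_vec_def matrix_vector_mult_def sum_distrib_left mult_ac)

lemma quadratic_form_upper_bound:
  fixes N :: "real ^ 'n ^ 'n"
  obtains p :: real where "p > 0" "\<And>v. v \<bullet> (N *v v) \<le> p * (norm v)\<^sup>2"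
proof -
  obtain b where b: "\<And>v. norm (N *v v) \<le> norm v * b" "b > 0"
    using bounded_linear.pos_bounded[OF matrix_vector_mul_bounded_linear[of N]] by auto
  have "v \<bullet> (N *v v) \<le> b * (norm v)\<^sup>2" for v
  proof -
    have "v \<bullet> (N *v v) \<le> norm v * norm (N *v v)" by (rule norm_cauchy_schwarz)
    also have "\<dots> \<le> norm v * (norm v * b)" by (intro mult_left_mono b) auto
    finally show ?thesis by (simp add: power2_eq_square mult_ac)
  qed
  then show thesis using that b(2) by blast
qed

text \<open>The constant is the minimum of the form on the unit sphere, attained by compactness and
  positive because the minimiser is nonzero. Homogeneity of degree two extends the bound to all
  vectors.\<close>

lemma pos_def_lower_bound:
  assumes "pos_def (N :: real ^ 'n ^ 'n)"
  obtains r where "r > 0" "\<And>v. r * (norm v)\<^sup>2 \<le> v \<bullet> (N *v v)"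
proof -
  have comp: "compact (sphere (0 :: real ^ 'n) 1)" by simp
  have ne: "sphere (0 :: real ^ 'n) 1 \<noteq> {}" by (simp add: sphere_eq_empty)
  have cont: "continuous_on (sphere 0 1) (\<lambda>v. v \<bullet> (N *v v))"
    by (intro continuous_intros linear_continuous_on matrix_vector_mul_bounded_linear)
  obtain a where a: "norm a = 1" "\<And>v. norm v = 1 \<Longrightarrow> a \<bullet> (N *v a) \<le> v \<bullet> (N *v v)"
    using continuous_attains_inf[OF comp ne cont] by auto
  have "a \<noteq> 0" using a(1) by auto
  then have pos: "a \<bullet> (N *v a) > 0" using assms by (auto simp: pos_def_def)
  have "a \<bullet> (N *v a) * (norm v)\<^sup>2 \<le> v \<bullet> (N *v v)" for v
  proof (cases "v = 0")
    case False
    define e where "e = v /\<^sub>R norm v"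
    have e: "norm e = 1" "norm v *\<^sub>R e = v" using False by (auto simp: e_def)
    then have "a \<bullet> (N *v a) * (norm v)\<^sup>2 \<le> (e \<bullet> (N *v e)) * (norm v)\<^sup>2"
      using a(2) by (intro mult_right_mono) auto
    also have "\<dots> = (norm v *\<^sub>R e) \<bullet> (N *v (norm v *\<^sub>R e))"
      by (simp add: matrix_vector_mult_scaleR power2_eq_square)
    also have "\<dots> = v \<bullet> (N *v v)" by (simp only: e(2))
    finally show ?thesis .
  qed simp
  then show thesis using that pos by blast
qed

lemma positive_form_invertible:
  fixes N :: "real ^ 'n ^ 'n"
  assumes "\<And>v. v \<noteq> 0 \<Longrightarrow> 0 < v \<bullet> (N *v v)"
  shows "invertible N"
proof -
  have "v = 0" if "N *v v = 0" for v
    using assms[of v] that by fastforce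
  then have "\<exists>N'. N' ** N = mat 1" by (simp add: matrix_left_invertible_ker)
  then show ?thesis by (auto simp: invertible_def matrix_left_right_inverse)
qed

section \<open>Completing the square\<close>

text \<open>The data without schedule and noise. \<open>S\<close> has its own name because it is the
  weight in the completed square.\<close>

locale lq_plant =
  fixes A P Q Z :: "real ^ 'n ^ 'n"
    and B :: "real ^ 'm ^ 'n"
    and C2 :: "real ^ 'n ^ 'p"
    and D21 :: "real ^ 'm ^ 'p"
    and R S :: "real ^ 'm ^ 'm"
    and K :: "real ^ 'n ^ 'm"
  assumes orthogonal: "transpose C2 ** D21 = 0"
    and Q_def: "Q = transpose C2 ** C2"
    and R_def: "R = transpose D21 ** D21"
    and R_pos: "pos_def R"
    and obs: "observable A C2"
    and P_pos: "pos_def P"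
    and riccati: "riccati_solution A B Q R P"
    and S_def: "S = transpose B ** P ** B + R"
    and Z_def: "Z = transpose A ** P ** B ** matrix_inv S ** transpose B ** P ** A"
    and K_def: "K = - (matrix_inv S ** transpose B ** P ** A)"
begin

lemma P_sym: "x \<bullet> (P *v y) = y \<bullet> (P *v x)"
  using P_pos inner_transpose_mult[of x P y] by (simp add: pos_def_def inner_commute del: transpose_matrix_vector)

lemma S_quadratic: "u \<bullet> (S *v v) = u \<bullet> (R *v v) + (B *v u) \<bullet> (P *v (B *v v))"
  by (simp add: S_def matrix_vector_mult_add_rdistrib inner_add_right
      matrix_vector_mul_assoc[symmetric] inner_transpose_mult del: transpose_matrix_vector)

lemma R_sym: "x \<bullet> (R *v y) = y \<bullet> (R *v x)"
  using R_pos inner_transpose_mult[of x R y] by (simp add: pos_def_def inner_commute del: transpose_matrix_vector)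

lemma S_sym: "x \<bullet> (S *v y) = y \<bullet> (S *v x)"
  by (metis S_quadratic P_sym R_sym)

lemma P_nonneg: "0 \<le> v \<bullet> (P *v v)"
  using P_pos by (cases "v = 0") (auto simp: pos_def_def less_imp_le)

lemma S_pos: "v \<noteq> 0 \<Longrightarrow> 0 < v \<bullet> (S *v v)"
  using R_pos P_nonneg[of "B *v v"] by (auto simp: S_quadratic pos_def_def add_pos_nonneg)

lemma S_nonneg: "0 \<le> v \<bullet> (S *v v)"
  using S_pos[of v] by (cases "v = 0") (auto simp: less_imp_le)

text \<open>Positivity of the form makes \<open>S\<close> invertible, so \<open>matrix_inv S\<close>
  is a genuine inverse and cancels.\<close>

lemma S_K: "S ** K = - (transpose B ** P ** A)"
proof -
  have "S ** matrix_inv S = mat 1"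
    using positive_form_invertible[OF S_pos] unfolding invertible_def matrix_inv_def
    by (rule someI2_ex) auto
  then have "S ** (matrix_inv S ** (transpose B ** P ** A)) = transpose B ** P ** A"
    by (simp add: matrix_mul_assoc)
  moreover have "S ** (- X) = - (S ** X)" for X :: "real ^ 'n ^ 'm"
    by (simp add: matrix_matrix_mult_def vec_eq_iff sum_negf)
  ultimately show ?thesis by (simp add: K_def matrix_mul_assoc)
qed

lemma inner_S_K: "u \<bullet> (S *v (K *v x)) = - ((B *v u) \<bullet> (P *v (A *v x)))"
proof -
  have "S *v (K *v x) = - (transpose B *v (P *v (A *v x)))"
    by (simp add: matrix_vector_mul_assoc S_K matrix_mul_assoc del: transpose_matrix_vector)
      (simp add: matrix_vector_mult_def vec_eq_iff sum_negf)
  then show ?thesis by (simp add: inner_transpose_mult del: transpose_matrix_vector)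
qed

text \<open>This is Z = K^T S K in bilinear form: the factors of \<open>Z\<close> from
  \<open>matrix_inv S\<close> onwards make up \<open>- K\<close>, and \<open>inner_S_K\<close> turns
  the rest into a product weighted by \<open>S\<close>.\<close>

lemma Z_quadratic: "x \<bullet> (Z *v y) = (K *v x) \<bullet> (S *v (K *v y))"
proof -
  have "x \<bullet> (Z *v y) = (A *v x) \<bullet> (P *v (B *v (matrix_inv S *v (transpose B *v (P *v (A *v y))))))"
    by (simp add: Z_def matrix_vector_mul_assoc[symmetric] inner_transpose_mult del: transpose_matrix_vector)
  also have "matrix_inv S *v (transpose B *v (P *v (A *v y))) = - (K *v y)"
    by (simp add: K_def matrix_vector_mul_assoc matrix_mul_assoc del: transpose_matrix_vector)
      (simp add: matrix_vector_mult_def vec_eq_iff sum_negf)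
  also have "(A *v x) \<bullet> (P *v (B *v (- (K *v y)))) = - ((B *v (K *v y)) \<bullet> (P *v (A *v x)))"
    by (subst P_sym) (simp add: linear_neg[OF matrix_vector_mul_linear])
  also have "\<dots> = (K *v y) \<bullet> (S *v (K *v x))" by (simp add: inner_S_K)
  finally show ?thesis by (simp add: S_sym)
qed

text \<open>The Riccati equation with its subtracted term recognised as \<open>Z\<close>.\<close>

lemma P_quadratic:
  "x \<bullet> (P *v y) = (A *v x) \<bullet> (P *v (A *v y)) + (C2 *v x) \<bullet> (C2 *v y) - x \<bullet> (Z *v y)"
proof -
  have "P = transpose A ** P ** A + Q - Z"
    using riccati by (simp add: riccati_solution_def Z_def S_def add.commute)
  then have "x \<bullet> (P *v y) = x \<bullet> ((transpose A ** P ** A + Q - Z) *v y)" by metis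
  then show ?thesis
    by (simp add: matrix_vector_mult_add_rdistrib matrix_vector_mult_diff_rdistrib
        inner_add_right inner_diff_right Q_def
        matrix_vector_mul_assoc[symmetric] inner_transpose_mult del: transpose_matrix_vector)
qed

text \<open>The orthogonality of \<open>C2\<close> and \<open>D21\<close> removes the cross
  term.\<close>

lemma norm_output: "(norm (C2 *v x + D21 *v u))\<^sup>2 = (norm (C2 *v x))\<^sup>2 + u \<bullet> (R *v u)"
proof -
  have "(C2 *v x) \<bullet> (D21 *v u) = x \<bullet> ((transpose C2 ** D21) *v u)"
    by (simp add: matrix_vector_mul_assoc[symmetric] inner_transpose_mult del: transpose_matrix_vector)
  then have "(C2 *v x) \<bullet> (D21 *v u) = 0" by (simp add: orthogonal)
  then show ?thesis
    by (simp add: power2_norm_eq_inner inner_add_left inner_add_right R_def inner_commute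
        matrix_vector_mul_assoc[symmetric] inner_transpose_mult del: transpose_matrix_vector)
qed

text \<open>Expanding the square of \<open>u - K *v x\<close> yields the input weight, the cross
  term between \<open>A *v x\<close> and \<open>B *v u\<close>, and a \<open>Z\<close>-term that
  cancels the one in the Riccati equation. The mixed noise term is kept linear in \<open>w\<close>,
  since in this form its expectation will vanish.\<close>

lemma complete_square:
  "(norm (C2 *v x + D21 *v u))\<^sup>2
     + (A *v x + B *v u + w) \<bullet> (P *v (A *v x + B *v u + w)) =
   x \<bullet> (P *v x) + (u - K *v x) \<bullet> (S *v (u - K *v x))
     + 2 * ((P *v (A *v x + B *v u)) \<bullet> w) + w \<bullet> (P *v w)"
proof -
  define a b where "a = A *v x" and "b = B *v u"
  have "(u - K *v x) \<bullet> (S *v (u - K *v x)) = u \<bullet> (S *v u) + 2 * (b \<bullet> (P *v a)) + x \<bullet> (Z *v x)"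
    using S_sym[of "K *v x" u]
    by (simp add: inner_diff_left inner_diff_right matrix_vector_mult_diff_distrib Z_quadratic
        inner_S_K a_def b_def)
  moreover have "(a + b + w) \<bullet> (P *v (a + b + w)) = a \<bullet> (P *v a) + b \<bullet> (P *v b) + w \<bullet> (P *v w)
      + 2 * (b \<bullet> (P *v a)) + 2 * ((P *v (a + b)) \<bullet> w)"
    using P_sym[of a b] P_sym[of a w] P_sym[of b w]
    by (simp add: matrix_vector_right_distrib inner_add_left inner_add_right inner_commute)
  ultimately show ?thesis
    unfolding norm_output P_quadratic[of x x]
    by (simp add: S_quadratic power2_norm_eq_inner a_def b_def)
qed

end

section \<open>Observability over a window\<close>

text \<open>Allows a bound on linear functionals to be checked on a spanning set: constants add
  under sums and scale by the absolute value of a factor.\<close>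

lemma subspace_abs_inner_bound:
  "subspace {v :: real ^ 'n. \<exists>c. \<forall>y. \<bar>y \<bullet> v\<bar> \<le> c * f y}"
proof (rule subspaceI)
  show "0 \<in> {v. \<exists>c. \<forall>y. \<bar>y \<bullet> v\<bar> \<le> c * f y}" by (auto intro!: exI[of _ 0])
next
  fix a b assume "a \<in> {v. \<exists>c. \<forall>y. \<bar>y \<bullet> v\<bar> \<le> c * f y}" "b \<in> {v. \<exists>c. \<forall>y. \<bar>y \<bullet> v\<bar> \<le> c * f y}"
  then obtain c d where "\<forall>y. \<bar>y \<bullet> a\<bar> \<le> c * f y" "\<forall>y. \<bar>y \<bullet> b\<bar> \<le> d * f y" by auto
  then have "\<bar>y \<bullet> (a + b)\<bar> \<le> (c + d) * f y" for y
    using abs_triangle_ineq[of "y \<bullet> a" "y \<bullet> b"]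
    by (simp add: inner_add_right distrib_right) (meson add_mono order_trans)
  then show "a + b \<in> {v. \<exists>c. \<forall>y. \<bar>y \<bullet> v\<bar> \<le> c * f y}" by blast
next
  fix k a assume "a \<in> {v. \<exists>c. \<forall>y. \<bar>y \<bullet> v\<bar> \<le> c * f y}"
  then obtain c where "\<forall>y. \<bar>y \<bullet> a\<bar> \<le> c * f y" by auto
  then have "\<bar>y \<bullet> (k *\<^sub>R a)\<bar> \<le> (\<bar>k\<bar> * c) * f y" for y
    by (simp add: abs_mult mult.assoc mult_left_mono)
  then show "k *\<^sub>R a \<in> {v. \<exists>c. \<forall>y. \<bar>y \<bullet> v\<bar> \<le> c * f y}" by blast
qed

text \<open>Every row of \<open>C ** mat_pow A i\<close> gives a functional bounded by the sum of
  output norms. These rows span the space, so the coordinate functionals are bounded as well, and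
  they control the norm.\<close>

lemma observable_norm_bound:
  fixes A :: "real ^ 'n ^ 'n" and C :: "real ^ 'n ^ 'p"
  assumes "observable A C"
  obtains c where "c \<ge> 0" "\<And>y. norm y \<le> c * (\<Sum>i<CARD('n). norm (C *v (mat_pow A i *v y)))"
proof -
  define f where "f y = (\<Sum>i<CARD('n). norm (C *v (mat_pow A i *v y)))" for y
  define V where "V = {v :: real ^ 'n. \<exists>c. \<forall>y. \<bar>y \<bullet> v\<bar> \<le> c * f y}"
  have f: "0 \<le> f y" for y by (simp add: f_def sum_nonneg)
  have "v \<in> V" if iv: "i < CARD('n)" "v \<in> rows (C ** mat_pow A i)" for i v
  proof -
    from iv obtain k where k: "v = row k (C ** mat_pow A i)" by (auto simp: rows_def)
    have "\<bar>y \<bullet> v\<bar> \<le> 1 * f y" for y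
    proof -
      have "y \<bullet> v = (C *v (mat_pow A i *v y)) $ k"
        unfolding k matrix_vector_mul_assoc
        by (simp add: row_def matrix_vector_mult_def inner_vec_def mult.commute)
      also have "\<bar>\<dots>\<bar> \<le> norm (C *v (mat_pow A i *v y))" by (rule component_le_norm_cart)
      also have "\<dots> \<le> f y" unfolding f_def using iv(1) by (intro member_le_sum) auto
      finally show ?thesis by simp
    qed
    then show ?thesis unfolding V_def by blast
  qed
  then have "(\<Union>i<CARD('n). rows (C ** mat_pow A i)) \<subseteq> V" by auto
  then have "span (\<Union>i<CARD('n). rows (C ** mat_pow A i)) \<subseteq> V"
    by (intro span_minimal) (auto simp: V_def subspace_abs_inner_bound)
  then have "V = UNIV" using assms by (auto simp: observable_def)
  then have "\<forall>k. \<exists>c. \<forall>y. \<bar>y \<bullet> axis k 1\<bar> \<le> c * f y" unfolding V_def by blast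
  then obtain c where c: "\<And>k y. \<bar>y \<bullet> axis k 1\<bar> \<le> c k * f y" by metis
  have "norm y \<le> (\<Sum>k\<in>UNIV. \<bar>c k\<bar>) * f y" for y
  proof -
    have "norm y \<le> (\<Sum>k\<in>UNIV. \<bar>y $ k\<bar>)" by (rule norm_le_l1_cart)
    also have "\<dots> \<le> (\<Sum>k\<in>UNIV. \<bar>c k\<bar> * f y)"
    proof (rule sum_mono)
      fix k
      have "\<bar>y $ k\<bar> \<le> c k * f y" using c[of y k] by (simp add: inner_axis)
      \<comment> \<open>The chosen constants carry no sign information; absolute values make the
        final constant nonnegative.\<close>
      also have "\<dots> \<le> \<bar>c k\<bar> * f y" using f by (intro mult_right_mono) auto
      finally show "\<bar>y $ k\<bar> \<le> \<bar>c k\<bar> * f y" .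
    qed
    finally show ?thesis by (simp add: sum_distrib_right)
  qed
  then show thesis using that[of "\<Sum>k\<in>UNIV. \<bar>c k\<bar>"] by (simp add: f_def sum_nonneg)
qed

text \<open>Only inputs and noise separate a trajectory from the free motion. The constant depends
  on the number of steps alone and serves all trajectories.\<close>

lemma trajectory_deviation:
  fixes A :: "real ^ 'n ^ 'n" and B :: "real ^ 'm ^ 'n"
  obtains c where "c \<ge> 0"
    "\<And>x u w. (\<And>j. j < i \<Longrightarrow> x (Suc j) = A *v x j + B *v u j + w j) \<Longrightarrow>
       norm (x i - mat_pow A i *v x 0) \<le> c * (\<Sum>j<i. norm (u j) + norm (w j))"
proof -
  obtain a where a: "\<And>v. norm (A *v v) \<le> norm v * a" "a > 0"
    using bounded_linear.pos_bounded[OF matrix_vector_mul_bounded_linear[of A]] by auto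
  obtain b where b: "\<And>v. norm (B *v v) \<le> norm v * b" "b > 0"
    using bounded_linear.pos_bounded[OF matrix_vector_mul_bounded_linear[of B]] by auto
  have "\<exists>c\<ge>0. \<forall>x u w. (\<forall>j<i. x (Suc j) = A *v x j + B *v u j + w j) \<longrightarrow>
       norm (x i - mat_pow A i *v x 0) \<le> c * (\<Sum>j<i. norm (u j) + norm (w j))"
  proof (induction i)
    case (Suc i)
    then obtain c where c: "c \<ge> 0"
      "\<And>x u w. (\<forall>j<i. x (Suc j) = A *v x j + B *v u j + w j) \<Longrightarrow>
       norm (x i - mat_pow A i *v x 0) \<le> c * (\<Sum>j<i. norm (u j) + norm (w j))" by blast
    \<comment> \<open>The three summands of the constant pay for the propagated deviation, the new
      input and the new noise.\<close>
    have "norm (x (Suc i) - mat_pow A (Suc i) *v x 0)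
        \<le> (c * a + b + 1) * (\<Sum>j<Suc i. norm (u j) + norm (w j))"
      if tr: "\<forall>j<Suc i. x (Suc j) = A *v x j + B *v u j + w j" for x u w
    proof -
      let ?s = "\<Sum>j<i. norm (u j) + norm (w j)"
      have s: "0 \<le> ?s" by (intro sum_nonneg) auto
      have "x (Suc i) - mat_pow A (Suc i) *v x 0 = A *v (x i - mat_pow A i *v x 0) + B *v u i + w i"
        using tr by (simp add: matrix_vector_mult_diff_distrib matrix_vector_mul_assoc)
      also have "norm \<dots> \<le> norm (A *v (x i - mat_pow A i *v x 0)) + norm (B *v u i) + norm (w i)"
        by (meson add_mono norm_triangle_ineq order_refl order_trans)
      also have "\<dots> \<le> (c * ?s) * a + norm (u i) * b + norm (w i)"
        using a(1)[of "x i - mat_pow A i *v x 0"] c(2)[of x u w] tr a(2) b(1)[of "u i"]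
        by (intro add_mono) (auto intro: order_trans mult_right_mono)
      also have "\<dots> \<le> (c * a + b + 1) * (?s + (norm (u i) + norm (w i)))"
        using s a(2) b(2) c(1) by (simp add: algebra_simps)
      finally show ?thesis by simp
    qed
    moreover have "c * a + b + 1 \<ge> 0" using a(2) b(2) c(1) by simp
    ultimately show ?case by blast
  qed auto
  then show thesis using that by blast
qed

context lq_plant
begin

text \<open>The free outputs of \<open>x 0\<close> determine its norm by observability. They differ
  from the actual outputs by the effect of inputs and noise, and the inputs are themselves bounded
  by the stage cost because \<open>R\<close> is positive definite.\<close>

lemma state_bound_by_window:
  obtains c where "c > 0"
    "\<And>x u w. (\<And>j. j < CARD('n) \<Longrightarrow> x (Suc j) = A *v x j + B *v u j + w j) \<Longrightarrow>
       (norm (x 0))\<^sup>2 \<le> c * (\<Sum>j<CARD('n). (norm (C2 *v x j + D21 *v u j))\<^sup>2 + (norm (w j))\<^sup>2)"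
proof -
  let ?n = "CARD('n)"
  obtain c0 where c0: "c0 \<ge> 0" "\<And>y. norm y \<le> c0 * (\<Sum>i<?n. norm (C2 *v (mat_pow A i *v y)))"
    using observable_norm_bound[OF obs] by blast
  obtain k where k: "\<And>v. norm (C2 *v v) \<le> norm v * k" "k > 0"
    using bounded_linear.pos_bounded[OF matrix_vector_mul_bounded_linear[of C2]] by auto
  \<comment> \<open>Packaging the bound as a predicate lets one constant be chosen for each number
    of steps.\<close>
  define dev where "dev i c \<longleftrightarrow> c \<ge> 0 \<and> (\<forall>x u w. (\<forall>j<i. x (Suc j) = A *v x j + B *v u j + w j) \<longrightarrow>
       norm (x i - mat_pow A i *v x 0) \<le> c * (\<Sum>j<i. norm (u j) + norm (w j)))" for i c
  have "\<exists>c. dev i c" for i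
    unfolding dev_def by (rule trajectory_deviation[of i A B]) blast
  then obtain d' where "\<And>i. dev i (d' i)" by metis
  then obtain d where d: "\<And>i. d i \<ge> 0"
    "\<And>i x u w. (\<forall>j<i. x (Suc j) = A *v x j + B *v u j + w j) \<Longrightarrow>
       norm (x i - mat_pow A i *v x 0) \<le> d i * (\<Sum>j<i. norm (u j) + norm (w j))"
    unfolding dev_def by blast
  obtain r where r: "r > 0" "\<And>v. r * (norm v)\<^sup>2 \<le> v \<bullet> (R *v v)"
    using pos_def_lower_bound[OF R_pos] by blast
  \<comment> \<open>Index \<open>i\<close> contributes 1 for the actual output and
    \<open>d i * k\<close> for the output of the deviation.\<close>
  define e where "e = c0 * (\<Sum>i<?n. 1 + d i * k)"
  have e: "e \<ge> 0" unfolding e_def using c0(1) d(1) k(2) by (intro mult_nonneg_nonneg sum_nonneg) auto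
  \<comment> \<open>The window length comes from the square of a sum over the window, 3 from the
    square of the three summands of \<open>E\<close>, and \<open>1 + 1 / r\<close> from bounding the
    input by \<open>R\<close>. Adding 1 keeps \<open>c\<close> positive even if \<open>e\<close> is
    0.\<close>
  define c where "c = e\<^sup>2 * (real ?n * (3 * (1 + 1 / r))) + 1"
  have c: "c > 0" using r(1) by (auto simp: c_def intro!: add_nonneg_pos)
  have "(norm (x 0))\<^sup>2 \<le> c * (\<Sum>j<?n. (norm (C2 *v x j + D21 *v u j))\<^sup>2 + (norm (w j))\<^sup>2)"
    if tr: "\<And>j. j < ?n \<Longrightarrow> x (Suc j) = A *v x j + B *v u j + w j" for x u w
  proof -
    define E where "E j = norm (C2 *v x j) + (norm (u j) + norm (w j))" for j
    define F where "F j = (norm (C2 *v x j + D21 *v u j))\<^sup>2 + (norm (w j))\<^sup>2" for j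
    have "norm (C2 *v (mat_pow A i *v x 0)) \<le> (1 + d i * k) * sum E {..<?n}" if i: "i < ?n" for i
    proof -
      have "C2 *v (mat_pow A i *v x 0) = C2 *v x i - C2 *v (x i - mat_pow A i *v x 0)"
        by (simp add: matrix_vector_mult_diff_distrib)
      then have "norm (C2 *v (mat_pow A i *v x 0)) \<le> norm (C2 *v x i) + norm (C2 *v (x i - mat_pow A i *v x 0))"
        by (metis norm_triangle_ineq4)
      also have "\<dots> \<le> norm (C2 *v x i) + (d i * (\<Sum>j<i. norm (u j) + norm (w j))) * k"
        using k(1)[of "x i - mat_pow A i *v x 0"] d(2)[of i x u w] tr i k(2)
        by (auto intro: order_trans mult_right_mono)
      finally have 1: "norm (C2 *v (mat_pow A i *v x 0))
        \<le> norm (C2 *v x i) + (d i * (\<Sum>j<i. norm (u j) + norm (w j))) * k" .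
      have 2: "(\<Sum>j<i. norm (u j) + norm (w j)) \<le> sum E {..<?n}"
      proof -
        have "(\<Sum>j<i. norm (u j) + norm (w j)) \<le> sum E {..<i}" by (intro sum_mono) (simp add: E_def)
        also have "\<dots> \<le> sum E {..<?n}" using i by (intro sum_mono2) (auto simp: E_def)
        finally show ?thesis .
      qed
      have 3: "norm (C2 *v x i) \<le> sum E {..<?n}"
      proof -
        have "norm (C2 *v x i) \<le> E i" by (simp add: E_def)
        also have "\<dots> \<le> sum E {..<?n}" using i by (intro member_le_sum) (auto simp: E_def)
        finally show ?thesis .
      qed
      have "(d i * (\<Sum>j<i. norm (u j) + norm (w j))) * k \<le> (d i * sum E {..<?n}) * k"
        using 2 d(1)[of i] k(2) by (intro mult_right_mono mult_left_mono) auto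
      with 1 3 show ?thesis by (simp add: algebra_simps)
    qed
    then have "(\<Sum>i<?n. norm (C2 *v (mat_pow A i *v x 0))) \<le> (\<Sum>i<?n. (1 + d i * k) * sum E {..<?n})"
      by (intro sum_mono) auto
    then have "c0 * (\<Sum>i<?n. norm (C2 *v (mat_pow A i *v x 0))) \<le> e * sum E {..<?n}"
      using c0(1) by (simp add: e_def sum_distrib_right mult_left_mono mult.assoc)
    with c0(2)[of "x 0"] have "norm (x 0) \<le> e * sum E {..<?n}" by linarith
    then have "(norm (x 0))\<^sup>2 \<le> (e * sum E {..<?n})\<^sup>2" by (intro power_mono) auto
    also have "\<dots> = e\<^sup>2 * (sum E {..<?n})\<^sup>2" by (simp add: power_mult_distrib)
    also have "(sum E {..<?n})\<^sup>2 \<le> real ?n * (\<Sum>j<?n. (E j)\<^sup>2)"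
      using sum_squared_le_sum_of_squares[of E "{..<?n}"] by (simp add: mult.commute)
    also have "(\<Sum>j<?n. (E j)\<^sup>2) \<le> (\<Sum>j<?n. 3 * (1 + 1 / r) * F j)"
    proof (rule sum_mono)
      fix j
      let ?a = "norm (C2 *v x j)" and ?b = "norm (u j)" and ?c = "norm (w j)"
      have "(E j)\<^sup>2 \<le> 3 * (?a\<^sup>2 + ?b\<^sup>2 + ?c\<^sup>2)"
        using zero_le_power2[of "?a - ?b"] zero_le_power2[of "?a - ?c"] zero_le_power2[of "?b - ?c"]
        by (simp add: E_def power2_eq_square algebra_simps)
      also have "?b\<^sup>2 \<le> (u j \<bullet> (R *v u j)) / r"
        using r(2)[of "u j"] r(1) by (simp add: field_simps)
      also have "?a\<^sup>2 + (u j \<bullet> (R *v u j)) / r + ?c\<^sup>2 \<le> (1 + 1 / r) * F j"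
      proof -
        have "0 \<le> ?a\<^sup>2 / r" "0 \<le> u j \<bullet> (R *v u j)" "0 \<le> ?c\<^sup>2 / r"
          using r(1) r(2)[of "u j"] by (auto intro: order_trans[rotated])
        then show ?thesis unfolding F_def norm_output by (simp add: algebra_simps add_divide_distrib)
      qed
      finally show "(E j)\<^sup>2 \<le> 3 * (1 + 1 / r) * F j" by (simp only: mult.assoc)
    qed
    finally have "(norm (x 0))\<^sup>2 \<le> e\<^sup>2 * (real ?n * (3 * (1 + 1 / r))) * sum F {..<?n}"
      by (simp add: sum_distrib_left[symmetric] mult_left_mono mult.assoc)
    also have "\<dots> \<le> c * sum F {..<?n}"
      by (intro mult_right_mono sum_nonneg) (auto simp: c_def F_def)
    finally show ?thesis by (simp add: F_def)
  qed
  then show thesis using that c by blast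
qed

end

section \<open>The sampling schedule\<close>

primrec last_sample :: "nat list \<Rightarrow> nat \<Rightarrow> nat" where
  "last_sample \<tau> 0 = 0"
| "last_sample \<tau> (Suc t) = (if sampled \<tau> (Suc t) then Suc t else last_sample \<tau> t)"

lemma last_sample_le: "last_sample \<tau> t \<le> t"
  by (induction t) auto

lemma sampled_0: "sampled \<tau> 0"
  unfolding sampled_def by (rule exI[of _ 0]) simp

lemma sampled_le_last_sample: "r \<le> t \<Longrightarrow> sampled \<tau> r \<Longrightarrow> r \<le> last_sample \<tau> t"
  by (induction t) (auto simp: le_Suc_eq)

lemma known_times_subset: "known_times \<tau> t \<subseteq> {..last_sample \<tau> t}"
  by (auto simp: known_times_def sampled_le_last_sample)

text \<open>The gramian at 0 vanishes, so the sum may start there. It then runs over exactly the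
  ages met in an interval of length \<open>p\<close>, with \<open>p = 1\<close> included.\<close>

lemma interval_cost_eq_sum: "p > 0 \<Longrightarrow> interval_cost A W Z p = (\<Sum>k<p. trace (Z ** noise_gramian A W k))"
proof -
  assume "p > 0"
  then have "{..<p} = insert 0 {1..p-1}" by auto
  then have "(\<Sum>k<p. trace (Z ** noise_gramian A W k)) = (\<Sum>k=1..p-1. trace (Z ** noise_gramian A W k))"
    by (simp add: noise_gramian_def)
  with \<open>p > 0\<close> show ?thesis by (auto simp: interval_cost_def trace_mult_sum)
qed

lemma periodic_nat_bounded:
  fixes g :: "nat \<Rightarrow> real"
  assumes "h > 0" "\<And>t. g (t + h) = g t"
  obtains C where "\<And>t. \<bar>g t\<bar> \<le> C"
proof -
  have mult: "g (t + m * h) = g t" for t m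
    by (induction m) (simp_all add: assms(2) add.assoc[symmetric] add.commute[of h])
  have "\<bar>g t\<bar> \<le> (\<Sum>i<h. \<bar>g i\<bar>)" for t
  proof -
    have "g t = g (t mod h)" using mult[of "t mod h" "t div h"] by (simp add: mod_mult_div_eq mult.commute)
    also have "\<bar>\<dots>\<bar> \<le> (\<Sum>i<h. \<bar>g i\<bar>)" using assms(1) by (intro member_le_sum) auto
    finally show ?thesis .
  qed
  then show thesis using that by blast
qed

locale schedule =
  fixes \<tau> :: "nat list"
  assumes nonempty: "\<tau> \<noteq> []" and positive: "\<forall>p\<in>set \<tau>. p > 0"
begin

lemma interval_pos: "\<tau> ! (l mod length \<tau>) > 0"
  using nonempty positive by simp

lemma sampling_time_mono: "strict_mono (sampling_time \<tau>)"
  by (rule strict_mono_Suc_iff[THEN iffD2]) (simp add: interval_pos)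

text \<open>Strict monotonicity excludes a sampling time strictly inside an interval, so the record
  is not updated there.\<close>

lemma last_sample_eq:
  "k < \<tau> ! (l mod length \<tau>) \<Longrightarrow> last_sample \<tau> (sampling_time \<tau> l + k) = sampling_time \<tau> l"
proof (induction k)
  case 0
  have "sampled \<tau> (sampling_time \<tau> l)" by (auto simp: sampled_def)
  then show ?case by (cases "sampling_time \<tau> l") auto
next
  case (Suc k)
  have "\<not> sampled \<tau> (sampling_time \<tau> l + Suc k)"
  proof
    assume "sampled \<tau> (sampling_time \<tau> l + Suc k)"
    then obtain i where i: "sampling_time \<tau> i = sampling_time \<tau> l + Suc k" by (auto simp: sampled_def)
    then have "sampling_time \<tau> l < sampling_time \<tau> i" "sampling_time \<tau> i < sampling_time \<tau> (Suc l)"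
      using Suc.prems by auto
    then show False using sampling_time_mono by (simp add: strict_mono_less del: sampling_time.simps)
  qed
  then show ?case using Suc by simp
qed

lemma sampling_interval_cases:
  obtains l k where "t = sampling_time \<tau> l + k" "k < \<tau> ! (l mod length \<tau>)"
proof -
  have "\<exists>l k. t = sampling_time \<tau> l + k \<and> k < \<tau> ! (l mod length \<tau>)"
  proof (induction t)
    case 0
    then show ?case using interval_pos[of 0] by (intro exI[of _ 0]) simp
  next
    case (Suc t)
    then obtain l k where lk: "t = sampling_time \<tau> l + k" "k < \<tau> ! (l mod length \<tau>)" by blast
    show ?case
    proof (cases "Suc k < \<tau> ! (l mod length \<tau>)")
      case True
      then show ?thesis using lk by (intro exI[of _ l] exI[of _ "Suc k"]) simp
    next
      case False
      then have "Suc t = sampling_time \<tau> (Suc l) + 0" using lk by simp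
      then show ?thesis using interval_pos[of "Suc l"] by blast
    qed
  qed
  then show thesis using that by blast
qed

lemma sampling_time_length: "sampling_time \<tau> (length \<tau>) = sum_list \<tau>"
proof -
  have "l \<le> length \<tau> \<Longrightarrow> sampling_time \<tau> l = (\<Sum>i<l. \<tau> ! i)" for l
    by (induction l) auto
  then show ?thesis by (simp add: sum_list_sum_nth atLeast0LessThan)
qed

lemma sampling_time_shift: "sampling_time \<tau> (l + length \<tau>) = sampling_time \<tau> l + sum_list \<tau>"
  by (induction l) (simp_all add: sampling_time_length)

lemma period_pos: "sum_list \<tau> > 0"
  using nonempty positive by (cases \<tau>) auto

text \<open>The covariance of the estimation error depends on time only through this number. The
  subtraction never truncates, by \<open>last_sample_le\<close>.\<close>

definition age :: "nat \<Rightarrow> nat" where "age t = t - last_sample \<tau> t"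

lemma age_eq: "k < \<tau> ! (l mod length \<tau>) \<Longrightarrow> age (sampling_time \<tau> l + k) = k"
  by (simp add: age_def last_sample_eq)

text \<open>A shift by one period moves the index of the interval by \<open>length \<tau>\<close>
  and keeps the position within it.\<close>

lemma age_periodic: "age (t + sum_list \<tau>) = age t"
proof -
  obtain l k where lk: "t = sampling_time \<tau> l + k" "k < \<tau> ! (l mod length \<tau>)"
    by (rule sampling_interval_cases)
  then have "t + sum_list \<tau> = sampling_time \<tau> (l + length \<tau>) + k"
    by (simp add: sampling_time_shift)
  then have "age (t + sum_list \<tau>) = k" using age_eq[of k "l + length \<tau>"] lk(2) by simp
  with lk show ?thesis by (simp add: age_eq)
qed

lemma sum_age_sampling_time:
  fixes f :: "nat \<Rightarrow> real"
  shows "(\<Sum>t<sampling_time \<tau> l. f (age t)) = (\<Sum>i<l. \<Sum>k<\<tau> ! (i mod length \<tau>). f k)"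
proof (induction l)
  case (Suc l)
  let ?s = "sampling_time \<tau> l" and ?p = "\<tau> ! (l mod length \<tau>)"
  have "(\<Sum>t<?s + n. f (age t)) = (\<Sum>t<?s. f (age t)) + (\<Sum>k<n. f (age (?s + k)))" for n
    by (induction n) (simp_all add: add.assoc)
  with Suc show ?case by (simp add: age_eq)
qed simp

text \<open>Subtracting the mean growth from the partial sums leaves a periodic function of
  \<open>T\<close>, which is bounded.\<close>

lemma sum_age_asymptotics:
  fixes f :: "nat \<Rightarrow> real"
  obtains C where
    "\<And>T. \<bar>(\<Sum>t<T. f (age t)) - real T * ((\<Sum>l<length \<tau>. \<Sum>k<\<tau> ! l. f k) / real (sum_list \<tau>))\<bar> \<le> C"
proof -
  let ?h = "sum_list \<tau>" and ?b = "\<Sum>l<length \<tau>. \<Sum>k<\<tau> ! l. f k"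
  have h: "(\<Sum>t<?h. f (age t)) = ?b"
    using sum_age_sampling_time[of f "length \<tau>"] by (simp add: sampling_time_length)
  have "(\<Sum>t<T + ?h. f (age t)) = (\<Sum>t<T. f (age t)) + ?b" for T
    by (induction T) (simp_all add: h age_periodic)
  then have per: "(\<Sum>t<T + ?h. f (age t)) - real (T + ?h) * (?b / real ?h)
      = (\<Sum>t<T. f (age t)) - real T * (?b / real ?h)" for T
    using period_pos by (simp add: distrib_right add_divide_distrib del: sum_list_eq_0_iff)
  show thesis
    by (rule periodic_nat_bounded[of ?h "\<lambda>T. (\<Sum>t<T. f (age t)) - real T * (?b / real ?h)", OF period_pos per])
      (rule that)
qed

end

section \<open>Square integrable random vectors\<close>

definition square_integrable :: "'a measure \<Rightarrow> ('a \<Rightarrow> 'b::euclidean_space) \<Rightarrow> bool" where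
  "square_integrable M X \<longleftrightarrow> X \<in> borel_measurable M \<and> integrable M (\<lambda>\<omega>. (norm (X \<omega>))\<^sup>2)"

lemma square_integrable_bounded:
  fixes X :: "'a \<Rightarrow> 'b::euclidean_space"
  assumes "X \<in> borel_measurable M" "integrable M f" "\<And>\<omega>. \<omega> \<in> space M \<Longrightarrow> (norm (X \<omega>))\<^sup>2 \<le> f \<omega>"
  shows "square_integrable M X"
  unfolding square_integrable_def
proof
  show "integrable M (\<lambda>\<omega>. (norm (X \<omega>))\<^sup>2)"
    using assms by (intro Bochner_Integration.integrable_bound[OF assms(2)]) (auto intro!: AE_I2 order_trans[OF assms(3)])
qed fact

lemma square_integrable_add:
  fixes X Y :: "'a \<Rightarrow> 'b::euclidean_space"
  assumes "square_integrable M X" "square_integrable M Y"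
  shows "square_integrable M (\<lambda>\<omega>. X \<omega> + Y \<omega>)"
proof (rule square_integrable_bounded[where f="\<lambda>\<omega>. 2 * ((norm (X \<omega>))\<^sup>2 + (norm (Y \<omega>))\<^sup>2)"])
  fix \<omega>
  have "(norm (X \<omega> + Y \<omega>))\<^sup>2 \<le> (norm (X \<omega>) + norm (Y \<omega>))\<^sup>2"
    by (intro power_mono norm_triangle_ineq) simp
  also have "\<dots> \<le> 2 * ((norm (X \<omega>))\<^sup>2 + (norm (Y \<omega>))\<^sup>2)"
    using zero_le_power2[of "norm (X \<omega>) - norm (Y \<omega>)"] by (simp add: power2_eq_square algebra_simps)
  finally show "(norm (X \<omega> + Y \<omega>))\<^sup>2 \<le> 2 * ((norm (X \<omega>))\<^sup>2 + (norm (Y \<omega>))\<^sup>2)" .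
qed (use assms in \<open>auto simp: square_integrable_def\<close>)

lemma square_integrable_mult_vec:
  fixes X :: "'a \<Rightarrow> real ^ 'n" and N :: "real ^ 'n ^ 'k"
  assumes "square_integrable M X"
  shows "square_integrable M (\<lambda>\<omega>. N *v X \<omega>)"
proof -
  obtain b where b: "\<And>v. norm (N *v v) \<le> norm v * b"
    using bounded_linear.bounded[OF matrix_vector_mul_bounded_linear[of N]] by auto
  have "(\<lambda>\<omega>. N *v X \<omega>) \<in> borel_measurable M"
    using assms borel_measurable_continuous_onI[OF linear_continuous_on[OF matrix_vector_mul_bounded_linear[of N]]]
    by (auto simp: square_integrable_def intro: measurable_compose)
  then show ?thesis
  proof (rule square_integrable_bounded[where f="\<lambda>\<omega>. (norm (X \<omega>))\<^sup>2 * b\<^sup>2"])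
    fix \<omega>
    show "(norm (N *v X \<omega>))\<^sup>2 \<le> (norm (X \<omega>))\<^sup>2 * b\<^sup>2"
      unfolding power_mult_distrib[symmetric] by (intro power_mono b) simp
  qed (use assms in \<open>auto simp: square_integrable_def\<close>)
qed

lemma square_integrable_uminus:
  "square_integrable M X \<Longrightarrow> square_integrable M (\<lambda>\<omega>. - X \<omega> :: 'b::euclidean_space)"
  by (simp add: square_integrable_def)

lemma square_integrable_diff:
  fixes X Y :: "'a \<Rightarrow> 'b::euclidean_space"
  assumes "square_integrable M X" "square_integrable M Y"
  shows "square_integrable M (\<lambda>\<omega>. X \<omega> - Y \<omega>)"
  using square_integrable_add[OF assms(1) square_integrable_uminus[OF assms(2)]] by simp

lemma square_integrable_inner:
  fixes X Y :: "'a \<Rightarrow> 'b::euclidean_space"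
  assumes "square_integrable M X" "square_integrable M Y"
  shows "integrable M (\<lambda>\<omega>. X \<omega> \<bullet> Y \<omega>)"
proof (rule Bochner_Integration.integrable_bound[where f="\<lambda>\<omega>. (norm (X \<omega>))\<^sup>2 + (norm (Y \<omega>))\<^sup>2"])
  show "AE \<omega> in M. norm (X \<omega> \<bullet> Y \<omega>) \<le> norm ((norm (X \<omega>))\<^sup>2 + (norm (Y \<omega>))\<^sup>2)"
  proof (rule AE_I2)
    fix \<omega>
    have "\<bar>X \<omega> \<bullet> Y \<omega>\<bar> \<le> norm (X \<omega>) * norm (Y \<omega>)" by (rule Cauchy_Schwarz_ineq2)
    also have "\<dots> \<le> (norm (X \<omega>))\<^sup>2 + (norm (Y \<omega>))\<^sup>2"
      using zero_le_power2[of "norm (X \<omega>) - norm (Y \<omega>)"] mult_nonneg_nonneg[of "norm (X \<omega>)" "norm (Y \<omega>)"]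
      unfolding power2_diff by (simp del: mult_nonneg_nonneg zero_le_power2)
    finally show "norm (X \<omega> \<bullet> Y \<omega>) \<le> norm ((norm (X \<omega>))\<^sup>2 + (norm (Y \<omega>))\<^sup>2)" by simp
  qed
qed (use assms in \<open>auto simp: square_integrable_def intro: borel_measurable_inner\<close>)

lemma (in prob_space) square_integrable_const: "square_integrable M (\<lambda>_. c :: 'b::euclidean_space)"
  by (simp add: square_integrable_def)

lemma (in prob_space) square_integrable_integrable:
  fixes X :: "'a \<Rightarrow> real ^ 'n"
  assumes "square_integrable M X"
  shows "integrable M (\<lambda>\<omega>. X \<omega> $ k)"
  using square_integrable_inner[OF assms square_integrable_const[of "axis k 1"]]
  by (simp add: inner_axis)

lemmas square_integrable_intros = square_integrable_add square_integrable_diff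
  square_integrable_mult_vec square_integrable_uminus

section \<open>Functions of the past noise\<close>

text \<open>The product space contains only functions restricted to \<open>{..<s}\<close>, whereas
  \<open>f\<close> is evaluated at whole noise sequences; the second condition links the
  two.\<close>

definition past :: "nat \<Rightarrow> ((nat \<Rightarrow> real ^ 'n) \<Rightarrow> 'b::topological_space) \<Rightarrow> bool" where
  "past s f \<longleftrightarrow> f \<in> borel_measurable (Pi\<^sub>M {..<s} (\<lambda>_. borel)) \<and>
     (\<forall>v v'. (\<forall>j<s. v j = v' j) \<longrightarrow> f v = f v')"

lemma past_restrict: "past s f \<Longrightarrow> f (restrict v {..<s}) = f v"
  by (auto simp: past_def)

text \<open>\<open>f\<close> is unchanged when its argument is first restricted to
  \<open>{..<s}\<close>, and that restriction is measurable from the larger product.\<close>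

lemma past_mono:
  assumes "past s f" "s \<le> r"
  shows "past r f"
proof -
  have "f \<circ> (\<lambda>v. restrict v {..<s}) \<in> borel_measurable (Pi\<^sub>M {..<r} (\<lambda>_. borel))"
    using assms by (intro measurable_comp[OF measurable_restrict_subset]) (auto simp: past_def)
  moreover have "f \<circ> (\<lambda>v. restrict v {..<s}) = f" using past_restrict[OF assms(1)] by auto
  ultimately show ?thesis using assms by (auto simp: past_def)
qed

lemma past_const: "past s (\<lambda>_. c)"
  by (simp add: past_def)

lemma past_coordinate: "j < s \<Longrightarrow> past s (\<lambda>v. v j)"
  by (auto simp: past_def intro!: measurable_component_singleton)

lemma past_add:
  fixes f g :: "(nat \<Rightarrow> real ^ 'n) \<Rightarrow> 'b::euclidean_space"
  shows "past s f \<Longrightarrow> past s g \<Longrightarrow> past s (\<lambda>v. f v + g v)"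
  unfolding past_def by (intro conjI allI impI borel_measurable_add arg_cong2[where f="(+)"]) blast+

lemma past_diff:
  fixes f g :: "(nat \<Rightarrow> real ^ 'n) \<Rightarrow> 'b::euclidean_space"
  shows "past s f \<Longrightarrow> past s g \<Longrightarrow> past s (\<lambda>v. f v - g v)"
  unfolding past_def by (intro conjI allI impI borel_measurable_diff arg_cong2[where f="(-)"]) blast+

lemma past_compose:
  "past s f \<Longrightarrow> g \<in> borel_measurable borel \<Longrightarrow> past s (\<lambda>v. g (f v))"
  unfolding past_def by (intro conjI allI impI arg_cong[where f=g] measurable_compose[of f _ borel g]) blast+

lemma borel_measurable_mult_vec: "(\<lambda>x. N *v x) \<in> borel_measurable borel" for N :: "real ^ 'n ^ 'k"
  by (intro borel_measurable_continuous_onI linear_continuous_on matrix_vector_mul_bounded_linear)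

lemma past_mult_vec: "past s f \<Longrightarrow> past s (\<lambda>v. N *v f v)" for N :: "real ^ 'n ^ 'k"
  by (rule past_compose[OF _ borel_measurable_mult_vec])

text \<open>Applied to inputs, where \<open>g\<close> is the policy and the family consists of the
  sampled states.\<close>

lemma past_family:
  assumes "\<And>r. r \<in> I \<Longrightarrow> past s (f r)" "g \<in> borel_measurable (Pi\<^sub>M I (\<lambda>_. borel))"
  shows "past s (\<lambda>v. g (\<lambda>r\<in>I. f r v))"
proof -
  have "(\<lambda>v. \<lambda>r\<in>I. f r v) \<in> measurable (Pi\<^sub>M {..<s} (\<lambda>_. borel)) (Pi\<^sub>M I (\<lambda>_. borel))"
    using assms(1) by (intro measurable_restrict) (simp add: past_def)
  then have "(\<lambda>v. g (\<lambda>r\<in>I. f r v)) \<in> borel_measurable (Pi\<^sub>M {..<s} (\<lambda>_. borel))"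
    using assms(2) by (rule measurable_compose)
  moreover have "g (\<lambda>r\<in>I. f r v) = g (\<lambda>r\<in>I. f r v')" if "\<forall>j<s. v j = v' j" for v v'
  proof -
    have "(\<lambda>r\<in>I. f r v) = (\<lambda>r\<in>I. f r v')"
      using assms(1) that by (intro restrict_ext) (auto simp: past_def)
    then show ?thesis by simp
  qed
  ultimately show ?thesis by (simp add: past_def)
qed

section \<open>Moments of the noise and its independence of the past\<close>

locale lq_system = lq_plant A P Q Z B C2 D21 R S K + schedule \<tau> + prob_space M
  for A P Q Z :: "real ^ 'n ^ 'n"
    and B :: "real ^ 'm ^ 'n"
    and C2 :: "real ^ 'n ^ 'p"
    and D21 :: "real ^ 'm ^ 'p"
    and R S :: "real ^ 'm ^ 'm"
    and K :: "real ^ 'n ^ 'm"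
    and \<tau> :: "nat list"
    and M :: "'a measure" +
  fixes w :: "nat \<Rightarrow> 'a \<Rightarrow> real ^ 'n"
    and W :: "real ^ 'n ^ 'n"
    and x0 :: "real ^ 'n"
  assumes indep: "indep_vars (\<lambda>_. borel) w UNIV"
    and mean: "\<And>t. has_bochner_integral M (w t) 0"
    and cov: "\<And>t. has_bochner_integral M (\<lambda>\<omega>. \<chi> i j. w t \<omega> $ i * w t \<omega> $ j) W"
begin

abbreviation noise :: "'a \<Rightarrow> nat \<Rightarrow> real ^ 'n" where "noise \<omega> \<equiv> \<lambda>s. w s \<omega>"

lemma w_measurable [measurable]: "w t \<in> borel_measurable M"
  using indep by (auto simp: indep_vars_def)

lemma noise_product:
  "integrable M (\<lambda>\<omega>. w t \<omega> $ i * w t \<omega> $ j)" "expectation (\<lambda>\<omega>. w t \<omega> $ i * w t \<omega> $ j) = W $ i $ j"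
proof -
  have "bounded_linear (\<lambda>N :: real ^ 'n ^ 'n. N $ i $ j)"
    using bounded_linear_compose[OF bounded_linear_vec_nth[of j] bounded_linear_vec_nth[of i]] by simp
  from has_bochner_integral_bounded_linear[OF this cov[of t]]
  have "has_bochner_integral M (\<lambda>\<omega>. w t \<omega> $ i * w t \<omega> $ j) (W $ i $ j)" by simp
  then show "integrable M (\<lambda>\<omega>. w t \<omega> $ i * w t \<omega> $ j)"
    "expectation (\<lambda>\<omega>. w t \<omega> $ i * w t \<omega> $ j) = W $ i $ j"
    by (auto dest: has_bochner_integral_integral_eq simp: integrable.intros)
qed

lemma noise_mean: "integrable M (\<lambda>\<omega>. w t \<omega> $ i)" "expectation (\<lambda>\<omega>. w t \<omega> $ i) = 0"
proof -
  have "has_bochner_integral M (\<lambda>\<omega>. w t \<omega> $ i) 0"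
    using has_bochner_integral_bounded_linear[OF bounded_linear_vec_nth[of i] mean[of t]] by simp
  then show "integrable M (\<lambda>\<omega>. w t \<omega> $ i)" "expectation (\<lambda>\<omega>. w t \<omega> $ i) = 0"
    by (auto dest: has_bochner_integral_integral_eq simp: integrable.intros)
qed

lemma noise_square_integrable: "square_integrable M (w t)"
proof -
  have "integrable M (\<lambda>\<omega>. \<Sum>i\<in>UNIV. w t \<omega> $ i * w t \<omega> $ i)"
    by (intro Bochner_Integration.integrable_sum noise_product)
  then show ?thesis by (simp add: square_integrable_def power2_norm_eq_inner inner_vec_def)
qed

lemma noise_quadratic: "expectation (\<lambda>\<omega>. w t \<omega> \<bullet> (N *v w t \<omega>)) = trace (N ** W)"
proof -
  \<comment> \<open>The form pairs \<open>N $ i $ j\<close> with \<open>W $ i $ j\<close>, the trace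
    with \<open>W $ j $ i\<close>; symmetry of \<open>W\<close> comes from commuting the two noise
    coordinates.\<close>
  have sym: "W $ i $ j = W $ j $ i" for i j
    using noise_product(2)[of t i j] noise_product(2)[of t j i] by (simp add: mult.commute)
  have "expectation (\<lambda>\<omega>. w t \<omega> \<bullet> (N *v w t \<omega>)) = (\<Sum>i\<in>UNIV. \<Sum>j\<in>UNIV. N $ i $ j * W $ i $ j)"
    by (simp add: inner_mult_vec_eq_sum Bochner_Integration.integral_sum noise_product
        Bochner_Integration.integrable_sum)
  also have "(\<Sum>i\<in>UNIV. \<Sum>j\<in>UNIV. N $ i $ j * W $ i $ j) = trace (N ** W)"
    unfolding trace_mult_eq_sum by (intro sum.cong refl arg_cong2[where f="(*)"] sym)
  finally show ?thesis .
qed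

lemma past_measurable:
  assumes "past s f"
  shows "(\<lambda>\<omega>. f (noise \<omega>)) \<in> borel_measurable M"
proof -
  have "(\<lambda>\<omega>. \<lambda>j\<in>{..<s}. w j \<omega>) \<in> measurable M (Pi\<^sub>M {..<s} (\<lambda>_. borel))"
    by (intro measurable_restrict) simp
  moreover have "f \<in> borel_measurable (Pi\<^sub>M {..<s} (\<lambda>_. borel))"
    using assms by (simp add: past_def)
  ultimately have "(\<lambda>\<omega>. f (\<lambda>j\<in>{..<s}. w j \<omega>)) \<in> borel_measurable M"
    by (rule measurable_compose)
  then show ?thesis using past_restrict[OF assms] by simp
qed

text \<open>The index sets \<open>{..<s}\<close> and \<open>{r}\<close> are disjoint, so the
  corresponding noise families are independent, and so are functions of them.\<close>

lemma past_indep: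
  assumes "past s f" "s \<le> r"
  shows "indep_var borel (\<lambda>\<omega>. f (noise \<omega>)) borel (w r)"
proof -
  have "indep_var (Pi\<^sub>M {..<s} (\<lambda>_. borel)) (\<lambda>\<omega>. \<lambda>j\<in>{..<s}. w j \<omega>) (Pi\<^sub>M {r} (\<lambda>_. borel)) (\<lambda>\<omega>. \<lambda>j\<in>{r}. w j \<omega>)"
    using assms by (intro indep_var_restrict[OF indep]) auto
  from indep_var_compose[OF this, of f borel "\<lambda>v. v r" borel] assms
  have "indep_var borel (f \<circ> (\<lambda>\<omega>. \<lambda>j\<in>{..<s}. w j \<omega>)) borel ((\<lambda>v. v r) \<circ> (\<lambda>\<omega>. \<lambda>j\<in>{r}. w j \<omega>))"
    by (auto simp: past_def)
  moreover have "f \<circ> (\<lambda>\<omega>. \<lambda>j\<in>{..<s}. w j \<omega>) = (\<lambda>\<omega>. f (noise \<omega>))"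
    using past_restrict[OF assms(1)] by auto
  moreover have "(\<lambda>v. v r) \<circ> (\<lambda>\<omega>. \<lambda>j\<in>{r}. w j \<omega>) = w r" by auto
  ultimately show ?thesis by simp
qed

text \<open>In each coordinate the expectation of the product factors by independence, and the noise
  has mean zero.\<close>

lemma past_orthogonal_noise:
  assumes "past s f" "s \<le> r" "square_integrable M (\<lambda>\<omega>. f (noise \<omega>))"
  shows "expectation (\<lambda>\<omega>. f (noise \<omega>) \<bullet> w r \<omega>) = 0"
proof -
  have "expectation (\<lambda>\<omega>. f (noise \<omega>) $ k * w r \<omega> $ k) = 0"
    and "integrable M (\<lambda>\<omega>. f (noise \<omega>) $ k * w r \<omega> $ k)" for k
  proof -
    have nth: "(\<lambda>v :: real ^ 'n. v $ k) \<in> borel_measurable borel" by simp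
    have ind: "indep_var borel (\<lambda>\<omega>. f (noise \<omega>) $ k) borel (\<lambda>\<omega>. w r \<omega> $ k)"
      using indep_var_compose[OF past_indep[OF assms(1,2)] nth nth] by (simp add: comp_def)
    show "expectation (\<lambda>\<omega>. f (noise \<omega>) $ k * w r \<omega> $ k) = 0"
      "integrable M (\<lambda>\<omega>. f (noise \<omega>) $ k * w r \<omega> $ k)"
      using indep_var_lebesgue_integral[OF ind] indep_var_integrable[OF ind]
        square_integrable_integrable[OF assms(3)] noise_mean by auto
  qed
  then show ?thesis by (simp add: inner_vec_def Bochner_Integration.integral_sum)
qed

end

section \<open>The closed loop\<close>

context lq_system
begin

text \<open>The controller has seen states up to the last sample only, so its input depends on the
  noise before that sample, even if \<open>t\<close> is much later.\<close>

lemma past_state_input: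
  assumes pol: "control_policy \<tau> \<mu>"
  shows past_state: "past t (\<lambda>v. state A B x0 \<tau> \<mu> v t)"
    and past_input: "last_sample \<tau> t \<le> s \<Longrightarrow> past s (\<lambda>v. control_input A B x0 \<tau> \<mu> v t)"
proof -
  \<comment> \<open>The claim on states enters as a premise, so that this fact can already be used
    inside the induction that proves that claim.\<close>
  have input: "past s (\<lambda>v. control_input A B x0 \<tau> \<mu> v t)"
    if "last_sample \<tau> t \<le> s" "\<And>r. r \<le> t \<Longrightarrow> past r (\<lambda>v. state A B x0 \<tau> \<mu> v r)" for s t
    unfolding control_input_def
  proof (rule past_family)
    fix r assume "r \<in> known_times \<tau> t"
    then have "r \<le> last_sample \<tau> t" "r \<le> t"
      using known_times_subset[of \<tau> t] by (auto simp: known_times_def)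
    then show "past s (\<lambda>v. state A B x0 \<tau> \<mu> v r)"
      using that past_mono[of r "\<lambda>v. state A B x0 \<tau> \<mu> v r" s] by auto
  qed (use pol in \<open>simp add: control_policy_def\<close>)
  have state: "past t (\<lambda>v. state A B x0 \<tau> \<mu> v t)" for t
  proof (induction t rule: less_induct)
    case (less t)
    show ?case
    proof (cases t)
      case (Suc i)
      have "past t (\<lambda>v. A *v state A B x0 \<tau> \<mu> v i + B *v control_input A B x0 \<tau> \<mu> v i + v i)"
      proof (intro past_add past_mult_vec)
        show "past t (\<lambda>v. state A B x0 \<tau> \<mu> v i)"
          using less[of i] past_mono[of i _ t] Suc by auto
        show "past t (\<lambda>v. control_input A B x0 \<tau> \<mu> v i)"
          using less Suc last_sample_le[of \<tau> i] by (intro input) auto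
        show "past t (\<lambda>v. v i)" using Suc by (intro past_coordinate) simp
      qed
      then show ?thesis by (simp add: Suc control_input_def)
    qed (simp add: past_const)
  qed
  show "past t (\<lambda>v. state A B x0 \<tau> \<mu> v t)" by (rule state)
  show "past s (\<lambda>v. control_input A B x0 \<tau> \<mu> v t)" if "last_sample \<tau> t \<le> s"
    by (rule input[OF that state])
qed

text \<open>The error of the estimate \<open>E[x\<^sub>t | J\<^sub>t]\<close>. It depends on the noise since the last sample only,
  not on the policy, and the estimate itself is \<open>state - estimation_error\<close>.\<close>

primrec estimation_error :: "(nat \<Rightarrow> real ^ 'n) \<Rightarrow> nat \<Rightarrow> real ^ 'n" where
  "estimation_error v 0 = 0"
| "estimation_error v (Suc t) = (if sampled \<tau> (Suc t) then 0 else A *v estimation_error v t + v t)"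

lemma past_estimation_error: "past t (\<lambda>v. estimation_error v t)"
proof (induction t)
  case (Suc t)
  show ?case
  proof (cases "sampled \<tau> (Suc t)")
    case False
    have "past (Suc t) (\<lambda>v. A *v estimation_error v t + v t)"
      by (intro past_add past_mult_vec past_mono[OF Suc] past_coordinate) auto
    with False show ?thesis by simp
  qed (simp add: past_const)
qed (simp add: past_const)

text \<open>At a sample the error is 0 and the estimate is the state itself. Between samples the new
  noise cancels in the difference, and the input depends only on noise before the last
  sample.\<close>

lemma past_estimate:
  assumes "control_policy \<tau> \<mu>"
  shows "past (last_sample \<tau> t) (\<lambda>v. state A B x0 \<tau> \<mu> v t - estimation_error v t)"
proof (induction t)
  case (Suc t)
  show ?case
  proof (cases "sampled \<tau> (Suc t)")
    case True
    then show ?thesis using past_state[OF assms, of "Suc t"] by simp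
  next
    case False
    have "past (last_sample \<tau> t) (\<lambda>v. A *v (state A B x0 \<tau> \<mu> v t - estimation_error v t)
        + B *v control_input A B x0 \<tau> \<mu> v t)"
      by (intro past_add past_mult_vec Suc past_input[OF assms]) simp
    with False show ?thesis
      by (simp add: control_input_def matrix_vector_mult_diff_distrib algebra_simps)
  qed
qed (simp add: past_const)

lemma estimation_error_square_integrable: "square_integrable M (\<lambda>\<omega>. estimation_error (noise \<omega>) t)"
proof (induction t)
  case (Suc t)
  then show ?case
    by (cases "sampled \<tau> (Suc t)")
      (simp_all add: square_integrable_const square_integrable_intros noise_square_integrable)
qed (simp add: square_integrable_const)

text \<open>Between samples the error splits into \<open>A\<close> applied to the old error and
  fresh noise. Moving \<open>A\<close> to the other side changes \<open>f\<close>, which is why the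
  induction leaves \<open>f\<close> arbitrary.\<close>

lemma estimation_error_orthogonal:
  assumes "past (last_sample \<tau> t) f" "square_integrable M (\<lambda>\<omega>. f (noise \<omega>))"
  shows "expectation (\<lambda>\<omega>. f (noise \<omega>) \<bullet> estimation_error (noise \<omega>) t) = 0"
  using assms
proof (induction t arbitrary: f)
  case (Suc t)
  show ?case
  proof (cases "sampled \<tau> (Suc t)")
    case False
    let ?g = "\<lambda>v. transpose A *v f v"
    have f: "past (last_sample \<tau> t) f" using Suc.prems(1) False by simp
    have "expectation (\<lambda>\<omega>. ?g (noise \<omega>) \<bullet> estimation_error (noise \<omega>) t) = 0"
      using Suc.prems(2) by (intro Suc.IH past_mult_vec f square_integrable_intros)
    moreover have "expectation (\<lambda>\<omega>. f (noise \<omega>) \<bullet> w t \<omega>) = 0"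
      using Suc.prems(2) last_sample_le by (intro past_orthogonal_noise[OF f])
    moreover have "f v \<bullet> estimation_error v (Suc t) = ?g v \<bullet> estimation_error v t + f v \<bullet> v t" for v
      using False by (simp add: inner_add_right inner_mult_vec_left transpose_transpose del: transpose_matrix_vector)
    moreover have "integrable M (\<lambda>\<omega>. ?g (noise \<omega>) \<bullet> estimation_error (noise \<omega>) t)"
      "integrable M (\<lambda>\<omega>. f (noise \<omega>) \<bullet> w t \<omega>)"
      using Suc.prems(2) by (intro square_integrable_inner square_integrable_intros
        estimation_error_square_integrable noise_square_integrable; assumption)+
    ultimately show ?thesis by (simp del: estimation_error.simps transpose_matrix_vector)
  qed simp
qed simp

text \<open>An unsampled step replaces \<open>N\<close> by \<open>transpose A ** N ** A\<close> on
  the old error, so \<open>N\<close> varies in the induction; cyclicity of the trace moves the outer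
  factors onto the gramian.\<close>

lemma estimation_error_quadratic:
  "expectation (\<lambda>\<omega>. estimation_error (noise \<omega>) t \<bullet> (N *v estimation_error (noise \<omega>) t))
     = trace (N ** noise_gramian A W (age t))"
proof (induction t arbitrary: N)
  case 0
  then show ?case by (simp add: age_def noise_gramian_def)
next
  case (Suc t)
  let ?e = "\<lambda>t \<omega>. estimation_error (noise \<omega>) t"
  show ?case
  proof (cases "sampled \<tau> (Suc t)")
    case True
    then show ?thesis by (simp add: age_def noise_gramian_def)
  next
    case False
    note sq = estimation_error_square_integrable[of t] noise_square_integrable[of t]
    have cross: "expectation (\<lambda>\<omega>. (G *v ?e t \<omega>) \<bullet> w t \<omega>) = 0" for G :: "real ^ 'n ^ 'n"
      by (rule past_orthogonal_noise[of t "\<lambda>v. G *v estimation_error v t"])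
        (intro past_mult_vec past_estimation_error square_integrable_intros sq order_refl)+
    \<comment> \<open>\<open>N\<close> is an arbitrary matrix, so the two cross terms carry
      \<open>N\<close> and its transpose separately.\<close>
    have "?e (Suc t) \<omega> \<bullet> (N *v ?e (Suc t) \<omega>) =
        ?e t \<omega> \<bullet> ((transpose A ** N ** A) *v ?e t \<omega>) + ((transpose N ** A) *v ?e t \<omega>) \<bullet> w t \<omega>
        + ((N ** A) *v ?e t \<omega>) \<bullet> w t \<omega> + w t \<omega> \<bullet> (N *v w t \<omega>)" for \<omega>
      using False
      by (simp add: matrix_vector_mul_assoc[symmetric] inner_mult_vec_left transpose_transpose
          matrix_vector_right_distrib inner_add_left inner_add_right inner_commute del: transpose_matrix_vector)
    moreover have "integrable M (\<lambda>\<omega>. ?e t \<omega> \<bullet> (G *v ?e t \<omega>))" "integrable M (\<lambda>\<omega>. (G *v ?e t \<omega>) \<bullet> w t \<omega>)"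
      "integrable M (\<lambda>\<omega>. w t \<omega> \<bullet> (G *v w t \<omega>))" for G :: "real ^ 'n ^ 'n"
      by (intro square_integrable_inner square_integrable_intros sq)+
    ultimately have "expectation (\<lambda>\<omega>. ?e (Suc t) \<omega> \<bullet> (N *v ?e (Suc t) \<omega>))
        = trace ((transpose A ** N ** A) ** noise_gramian A W (age t)) + trace (N ** W)"
      by (simp add: cross noise_quadratic Suc.IH)
    also have "trace ((transpose A ** N ** A) ** noise_gramian A W (age t))
        = trace (N ** (A ** noise_gramian A W (age t) ** transpose A))"
      using trace_mul_sym[of "transpose A" "N ** A ** noise_gramian A W (age t)"]
      by (simp add: matrix_mul_assoc)
    also have "\<dots> + trace (N ** W) = trace (N ** noise_gramian A W (Suc (age t)))"
      by (simp add: noise_gramian_Suc matrix_add_ldistrib trace_add)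
    also have "Suc (age t) = age (Suc t)" using False last_sample_le[of \<tau> t] by (simp add: age_def)
    finally show ?thesis .
  qed
qed

section \<open>The expected cost of one step\<close>

lemma state_Suc:
  "state A B x0 \<tau> \<mu> v (Suc t) = A *v state A B x0 \<tau> \<mu> v t + B *v control_input A B x0 \<tau> \<mu> v t + v t"
  by (simp add: control_input_def)

lemma state_square_integrable:
  assumes "\<And>i. i < t \<Longrightarrow> square_integrable M (\<lambda>\<omega>. control_input A B x0 \<tau> \<mu> (noise \<omega>) i)"
  shows "square_integrable M (\<lambda>\<omega>. state A B x0 \<tau> \<mu> (noise \<omega>) t)"
  using assms
proof (induction t)
  case (Suc t)
  then show ?case unfolding state_Suc
    by (intro square_integrable_intros noise_square_integrable) auto
qed (simp add: square_integrable_const)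

text \<open>A Bochner integral, with value 0 if the integrand is not integrable; it is the true
  expected cost when the inputs up to \<open>t\<close> are square integrable.\<close>

definition stage_cost :: "(nat \<Rightarrow> (nat \<Rightarrow> real ^ 'n) \<Rightarrow> real ^ 'm) \<Rightarrow> nat \<Rightarrow> real" where
  "stage_cost \<mu> t = expectation (\<lambda>\<omega>. (norm (system_output A B C2 D21 x0 \<tau> \<mu> (noise \<omega>) t))\<^sup>2)"

definition value_at :: "(nat \<Rightarrow> (nat \<Rightarrow> real ^ 'n) \<Rightarrow> real ^ 'm) \<Rightarrow> nat \<Rightarrow> real" where
  "value_at \<mu> t = expectation (\<lambda>\<omega>. state A B x0 \<tau> \<mu> (noise \<omega>) t \<bullet> (P *v state A B x0 \<tau> \<mu> (noise \<omega>) t))"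

text \<open>Compares the input with the gain applied to the estimate, not to the state. Under a
  policy the result depends only on noise before the last sample.\<close>

definition input_deviation ::
    "(nat \<Rightarrow> (nat \<Rightarrow> real ^ 'n) \<Rightarrow> real ^ 'm) \<Rightarrow> (nat \<Rightarrow> real ^ 'n) \<Rightarrow> nat \<Rightarrow> real ^ 'm" where
  "input_deviation \<mu> v t = control_input A B x0 \<tau> \<mu> v t - K *v (state A B x0 \<tau> \<mu> v t - estimation_error v t)"

lemma output_square_integrable:
  assumes "\<And>i. i \<le> t \<Longrightarrow> square_integrable M (\<lambda>\<omega>. control_input A B x0 \<tau> \<mu> (noise \<omega>) i)"
  shows "square_integrable M (\<lambda>\<omega>. system_output A B C2 D21 x0 \<tau> \<mu> (noise \<omega>) t)"
  unfolding system_output_def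
  by (intro square_integrable_intros state_square_integrable assms) auto

text \<open>Takes expectations in \<open>complete_square\<close>. The distance of the input from
  \<open>K *v x\<close> is the input deviation minus \<open>K\<close> times the error; their mixed
  term has mean zero, and the square of the error part gives the trace with
  \<open>Z\<close>.\<close>

lemma stage_cost_step:
  assumes pol: "control_policy \<tau> \<mu>"
    and sq: "\<And>i. i \<le> t \<Longrightarrow> square_integrable M (\<lambda>\<omega>. control_input A B x0 \<tau> \<mu> (noise \<omega>) i)"
  shows "stage_cost \<mu> t + value_at \<mu> (Suc t) = value_at \<mu> t
      + expectation (\<lambda>\<omega>. input_deviation \<mu> (noise \<omega>) t \<bullet> (S *v input_deviation \<mu> (noise \<omega>) t))
      + trace (Z ** noise_gramian A W (age t)) + trace (P ** W)"
proof -
  let ?x = "\<lambda>t \<omega>. state A B x0 \<tau> \<mu> (noise \<omega>) t" and ?u = "\<lambda>\<omega>. control_input A B x0 \<tau> \<mu> (noise \<omega>) t"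
  let ?z = "\<lambda>\<omega>. system_output A B C2 D21 x0 \<tau> \<mu> (noise \<omega>) t"
  let ?e = "\<lambda>\<omega>. estimation_error (noise \<omega>) t" and ?a = "\<lambda>\<omega>. input_deviation \<mu> (noise \<omega>) t"
  let ?f = "\<lambda>v. P *v (A *v state A B x0 \<tau> \<mu> v t + B *v control_input A B x0 \<tau> \<mu> v t)"
  \<comment> \<open>Moving \<open>K\<close> off the error puts the mixed term in the shape required
    by \<open>estimation_error_orthogonal\<close>.\<close>
  let ?g = "\<lambda>v. transpose K *v (S *v input_deviation \<mu> v t)"
  have x: "square_integrable M (?x t)" "square_integrable M (?x (Suc t))"
    using sq by (intro state_square_integrable; simp)+
  have u: "square_integrable M ?u" using sq by simp
  have z: "square_integrable M ?z" using sq by (intro output_square_integrable)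
  note e = estimation_error_square_integrable[of t] and ws = noise_square_integrable[of t]
  have a: "square_integrable M ?a"
    unfolding input_deviation_def by (intro square_integrable_intros x u e)
  have pa: "past (last_sample \<tau> t) (\<lambda>v. input_deviation \<mu> v t)"
    unfolding input_deviation_def
    by (intro past_diff past_mult_vec past_input[OF pol] past_estimate[OF pol]) simp
  have pf: "past t ?f"
    by (intro past_add past_mult_vec past_state[OF pol] past_input[OF pol] last_sample_le)
  have f0: "expectation (\<lambda>\<omega>. ?f (noise \<omega>) \<bullet> w t \<omega>) = 0"
    by (rule past_orthogonal_noise[OF pf order_refl]) (intro square_integrable_intros x u)
  have g0: "expectation (\<lambda>\<omega>. ?g (noise \<omega>) \<bullet> ?e \<omega>) = 0"
    by (rule estimation_error_orthogonal) (intro past_mult_vec pa square_integrable_intros a)+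
  have split: "?u \<omega> - K *v ?x t \<omega> = ?a \<omega> - K *v ?e \<omega>" for \<omega>
    by (simp add: input_deviation_def matrix_vector_mult_diff_distrib)
  have quad: "(?u \<omega> - K *v ?x t \<omega>) \<bullet> (S *v (?u \<omega> - K *v ?x t \<omega>))
      = ?a \<omega> \<bullet> (S *v ?a \<omega>) - 2 * (?g (noise \<omega>) \<bullet> ?e \<omega>) + ?e \<omega> \<bullet> (Z *v ?e \<omega>)" for \<omega>
    unfolding split using S_sym[of "K *v ?e \<omega>" "?a \<omega>"]
    by (simp add: Z_quadratic matrix_vector_mult_diff_distrib inner_diff_left inner_diff_right
        inner_mult_vec_left transpose_transpose inner_commute del: transpose_matrix_vector)
  have pointwise: "(norm (?z \<omega>))\<^sup>2 + ?x (Suc t) \<omega> \<bullet> (P *v ?x (Suc t) \<omega>) =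
      ?x t \<omega> \<bullet> (P *v ?x t \<omega>) + (?a \<omega> \<bullet> (S *v ?a \<omega>) - 2 * (?g (noise \<omega>) \<bullet> ?e \<omega>) + ?e \<omega> \<bullet> (Z *v ?e \<omega>))
      + 2 * (?f (noise \<omega>) \<bullet> w t \<omega>) + w t \<omega> \<bullet> (P *v w t \<omega>)" for \<omega>
    unfolding quad[symmetric] system_output_def state_Suc by (rule complete_square)
  have int_z: "integrable M (\<lambda>\<omega>. (norm (?z \<omega>))\<^sup>2)"
    using z by (simp add: square_integrable_def)
  have int: "integrable M (\<lambda>\<omega>. ?x (Suc t) \<omega> \<bullet> (P *v ?x (Suc t) \<omega>))"
    "integrable M (\<lambda>\<omega>. ?x t \<omega> \<bullet> (P *v ?x t \<omega>))" "integrable M (\<lambda>\<omega>. ?a \<omega> \<bullet> (S *v ?a \<omega>))"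
    "integrable M (\<lambda>\<omega>. ?g (noise \<omega>) \<bullet> ?e \<omega>)" "integrable M (\<lambda>\<omega>. ?e \<omega> \<bullet> (Z *v ?e \<omega>))"
    "integrable M (\<lambda>\<omega>. ?f (noise \<omega>) \<bullet> w t \<omega>)" "integrable M (\<lambda>\<omega>. w t \<omega> \<bullet> (P *v w t \<omega>))"
    by (intro square_integrable_inner square_integrable_intros x u a e ws)+
  have "expectation (\<lambda>\<omega>. (norm (?z \<omega>))\<^sup>2) + expectation (\<lambda>\<omega>. ?x (Suc t) \<omega> \<bullet> (P *v ?x (Suc t) \<omega>))
     = expectation (\<lambda>\<omega>. (norm (?z \<omega>))\<^sup>2 + ?x (Suc t) \<omega> \<bullet> (P *v ?x (Suc t) \<omega>))"
    by (rule Bochner_Integration.integral_add[OF int_z int(1), symmetric])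
  also have "\<dots> = expectation (\<lambda>\<omega>. ?x t \<omega> \<bullet> (P *v ?x t \<omega>)) + (expectation (\<lambda>\<omega>. ?a \<omega> \<bullet> (S *v ?a \<omega>))
      - 2 * expectation (\<lambda>\<omega>. ?g (noise \<omega>) \<bullet> ?e \<omega>) + expectation (\<lambda>\<omega>. ?e \<omega> \<bullet> (Z *v ?e \<omega>)))
      + 2 * expectation (\<lambda>\<omega>. ?f (noise \<omega>) \<bullet> w t \<omega>) + expectation (\<lambda>\<omega>. w t \<omega> \<bullet> (P *v w t \<omega>))"
    unfolding pointwise using int by (simp del: transpose_matrix_vector)
  finally show ?thesis
    unfolding f0 g0 noise_quadratic estimation_error_quadratic stage_cost_def value_at_def by simp
qed

end

section \<open>Long-run behaviour of the cost\<close>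

lemma bounded_by_contraction:
  fixes V :: "nat \<Rightarrow> real"
  assumes "n > 0" "0 \<le> q" "q < 1" and step: "\<And>t. V (t + n) \<le> q * V t + d"
  obtains b where "\<And>t. V t \<le> b"
proof -
  \<comment> \<open>The first entry is the fixed point of the map \<open>q * y + d\<close>, so
    values below \<open>b\<close> stay below \<open>b\<close>; the second covers the first
    \<open>n\<close> indices.\<close>
  define b where "b = max (d / (1 - q)) (\<Sum>i<n. \<bar>V i\<bar>)"
  have "d / (1 - q) \<le> b" by (simp add: b_def)
  then have b: "q * b + d \<le> b" using assms(3) by (simp add: field_simps)
  have "V t \<le> b" for t
  proof (induction t rule: less_induct)
    case (less t)
    show ?case
    proof (cases "t < n")
      case True
      then have "\<bar>V t\<bar> \<le> (\<Sum>i<n. \<bar>V i\<bar>)" by (intro member_le_sum) auto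
      then show ?thesis by (simp add: b_def)
    next
      case False
      then have "V t \<le> q * V (t - n) + d" using step[of "t - n"] by simp
      also have "\<dots> \<le> q * b + d"
        using less[of "t - n"] False assms(1,2) by (intro add_right_mono mult_left_mono) auto
      finally show ?thesis using b by simp
    qed
  qed
  then show thesis using that by blast
qed

lemma sum_lessThan_add: "(\<Sum>t<k + N. s t) = (\<Sum>t<k. s t) + (\<Sum>i<N. s (k + i))"
  for s :: "nat \<Rightarrow> real"
  by (induction N) (simp_all add: add.assoc)

context lq_system
begin

definition optimal_value :: real where
  "optimal_value = trace (P ** W)
     + (\<Sum>l<length \<tau>. interval_cost A W Z (\<tau> ! l)) / real (sum_list \<tau>)"

abbreviation admissible :: "(nat \<Rightarrow> (nat \<Rightarrow> real ^ 'n) \<Rightarrow> real ^ 'm) \<Rightarrow> nat \<Rightarrow> bool" where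
  "admissible \<mu> T \<equiv> \<forall>i<T. square_integrable M (\<lambda>\<omega>. control_input A B x0 \<tau> \<mu> (noise \<omega>) i)"

section \<open>Finite cost, admissible inputs and bounds on the terminal value\<close>

lemma admissible_state: "admissible \<mu> T \<Longrightarrow> t \<le> T \<Longrightarrow>
    square_integrable M (\<lambda>\<omega>. state A B x0 \<tau> \<mu> (noise \<omega>) t)"
  by (intro state_square_integrable) auto

lemma admissible_output: "admissible \<mu> T \<Longrightarrow> t < T \<Longrightarrow>
    integrable M (\<lambda>\<omega>. (norm (system_output A B C2 D21 x0 \<tau> \<mu> (noise \<omega>) t))\<^sup>2)"
  using output_square_integrable[of t \<mu>] by (simp add: square_integrable_def)

lemma average_cost_eq:
  assumes "admissible \<mu> T" "T > 0"
  shows "average_cost M w A B C2 D21 x0 \<tau> \<mu> T = ereal ((\<Sum>t<T. stage_cost \<mu> t) / real T)"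
proof -
  let ?z = "\<lambda>t \<omega>. (norm (system_output A B C2 D21 x0 \<tau> \<mu> (noise \<omega>) t))\<^sup>2"
  have "(\<integral>\<^sup>+ \<omega>. ennreal (\<Sum>t<T. ?z t \<omega>) \<partial>M) = ennreal (expectation (\<lambda>\<omega>. \<Sum>t<T. ?z t \<omega>))"
    using admissible_output[OF assms(1)]
    by (intro nn_integral_eq_integral Bochner_Integration.integrable_sum) (auto intro!: AE_I2 sum_nonneg)
  also have "expectation (\<lambda>\<omega>. \<Sum>t<T. ?z t \<omega>) = (\<Sum>t<T. stage_cost \<mu> t)"
    using admissible_output[OF assms(1)]
    by (simp add: stage_cost_def Bochner_Integration.integral_sum)
  finally show ?thesis
    unfolding average_cost_def using assms(2)
    by (simp add: enn2ereal_ennreal sum_nonneg stage_cost_def)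
qed

lemma output_measurable:
  assumes "control_policy \<tau> \<mu>"
  shows "(\<lambda>\<omega>. system_output A B C2 D21 x0 \<tau> \<mu> (noise \<omega>) t) \<in> borel_measurable M"
  unfolding system_output_def
  by (rule past_measurable[of t])
    (intro past_add past_mult_vec past_state[OF assms] past_input[OF assms] last_sample_le)

text \<open>Since \<open>R\<close> is positive definite, the total output cost divided by
  \<open>r\<close> dominates the square of every input before \<open>T\<close>.\<close>

lemma finite_cost_admissible:
  assumes pol: "control_policy \<tau> \<mu>" and fin: "average_cost M w A B C2 D21 x0 \<tau> \<mu> T \<noteq> \<infinity>" and T: "T > 0"
  shows "admissible \<mu> T"
proof (intro allI impI)
  fix i assume i: "i < T"
  let ?z = "\<lambda>t \<omega>. (norm (system_output A B C2 D21 x0 \<tau> \<mu> (noise \<omega>) t))\<^sup>2"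
  obtain r where r: "r > 0" "\<And>v. r * (norm v)\<^sup>2 \<le> v \<bullet> (R *v v)"
    using pos_def_lower_bound[OF R_pos] by blast
  have "(\<integral>\<^sup>+ \<omega>. ennreal (\<Sum>t<T. ?z t \<omega>) \<partial>M) \<noteq> \<infinity>"
  proof
    assume "(\<integral>\<^sup>+ \<omega>. ennreal (\<Sum>t<T. ?z t \<omega>) \<partial>M) = \<infinity>"
    then show False using fin T by (simp add: average_cost_def)
  qed
  then have int: "integrable M (\<lambda>\<omega>. \<Sum>t<T. ?z t \<omega>)"
    using output_measurable[OF pol]
    by (intro integrableI_nonneg) (auto intro!: AE_I2 sum_nonneg simp: less_top)
  show "square_integrable M (\<lambda>\<omega>. control_input A B x0 \<tau> \<mu> (noise \<omega>) i)"
  proof (rule square_integrable_bounded)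
    show "(\<lambda>\<omega>. control_input A B x0 \<tau> \<mu> (noise \<omega>) i) \<in> borel_measurable M"
      by (rule past_measurable[OF past_input[OF pol last_sample_le]])
    show "integrable M (\<lambda>\<omega>. (\<Sum>t<T. ?z t \<omega>) / r)" using int by simp
    fix \<omega>
    have "r * (norm (control_input A B x0 \<tau> \<mu> (noise \<omega>) i))\<^sup>2 \<le> ?z i \<omega>"
      unfolding system_output_def norm_output using r(2) by (simp add: add_increasing)
    also have "\<dots> \<le> (\<Sum>t<T. ?z t \<omega>)" using i by (intro member_le_sum) auto
    finally show "(norm (control_input A B x0 \<tau> \<mu> (noise \<omega>) i))\<^sup>2 \<le> (\<Sum>t<T. ?z t \<omega>) / r"
      using r(1) by (simp add: field_simps)
  qed
qed

lemma stage_cost_nonneg: "0 \<le> stage_cost \<mu> t"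
  by (simp add: stage_cost_def)

lemma value_at_nonneg: "0 \<le> value_at \<mu> t"
  by (simp add: value_at_def P_nonneg)

text \<open>The expectation of \<open>state_bound_by_window\<close> along the trajectory from time
  \<open>t\<close>. The constants serve all policies and times.\<close>

lemma value_at_window:
  obtains c d where "c \<ge> 1"
    "\<And>\<mu> t. admissible \<mu> (t + CARD('n)) \<Longrightarrow>
       value_at \<mu> t \<le> c * (\<Sum>j<CARD('n). stage_cost \<mu> (t + j)) + d"
proof -
  let ?n = "CARD('n)"
  obtain c0 where c0: "c0 > 0"
    "\<And>x u w. (\<And>j. j < ?n \<Longrightarrow> x (Suc j) = A *v x j + B *v u j + w j) \<Longrightarrow>
       (norm (x 0))\<^sup>2 \<le> c0 * (\<Sum>j<?n. (norm (C2 *v x j + D21 *v u j))\<^sup>2 + (norm (w j))\<^sup>2)"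
    using state_bound_by_window by blast
  obtain p where p: "p > 0" "\<And>v. v \<bullet> (P *v v) \<le> p * (norm v)\<^sup>2"
    using quadratic_form_upper_bound[of P] by blast
  have noise_power: "expectation (\<lambda>\<omega>. (norm (w t \<omega>))\<^sup>2) = trace W" for t
    using noise_quadratic[of t "mat 1"] by (simp add: power2_norm_eq_inner)
  \<comment> \<open>Raising the factor to at least 1 is harmless as stage costs are nonnegative, and
    it makes \<open>1 - 1 / c\<close> a valid contraction factor later.\<close>
  have "value_at \<mu> t \<le> max 1 (p * c0) * (\<Sum>j<?n. stage_cost \<mu> (t + j)) + p * c0 * (real ?n * trace W)"
    if adm: "admissible \<mu> (t + ?n)" for \<mu> t
  proof -
    let ?x = "\<lambda>t \<omega>. state A B x0 \<tau> \<mu> (noise \<omega>) t"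
    let ?z = "\<lambda>t \<omega>. system_output A B C2 D21 x0 \<tau> \<mu> (noise \<omega>) t"
    have x: "square_integrable M (?x t)" by (rule admissible_state[OF adm]) simp
    have int: "integrable M (\<lambda>\<omega>. (norm (?z (t + j) \<omega>))\<^sup>2)" if "j < ?n" for j
      using that by (intro admissible_output[OF adm]) simp
    have intw: "integrable M (\<lambda>\<omega>. (norm (w (t + j) \<omega>))\<^sup>2)" for j
      using noise_square_integrable by (simp add: square_integrable_def)
    have "value_at \<mu> t \<le> expectation (\<lambda>\<omega>. p * c0 * (\<Sum>j<?n. (norm (?z (t + j) \<omega>))\<^sup>2 + (norm (w (t + j) \<omega>))\<^sup>2))"
      unfolding value_at_def
    proof (rule integral_mono)
      show "integrable M (\<lambda>\<omega>. ?x t \<omega> \<bullet> (P *v ?x t \<omega>))"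
        by (intro square_integrable_inner square_integrable_intros x)
      show "integrable M (\<lambda>\<omega>. p * c0 * (\<Sum>j<?n. (norm (?z (t + j) \<omega>))\<^sup>2 + (norm (w (t + j) \<omega>))\<^sup>2))"
        using int intw by (intro Bochner_Integration.integrable_sum integrable_mult_right Bochner_Integration.integrable_add) auto
      fix \<omega>
      have "(norm (?x t \<omega>))\<^sup>2 \<le> c0 * (\<Sum>j<?n. (norm (?z (t + j) \<omega>))\<^sup>2 + (norm (w (t + j) \<omega>))\<^sup>2)"
        unfolding system_output_def
        using c0(2)[of "\<lambda>j. ?x (t + j) \<omega>" "\<lambda>j. control_input A B x0 \<tau> \<mu> (noise \<omega>) (t + j)" "\<lambda>j. w (t + j) \<omega>"]
        by (simp add: state_Suc del: state.simps)
      then have "p * (norm (?x t \<omega>))\<^sup>2 \<le> p * c0 * (\<Sum>j<?n. (norm (?z (t + j) \<omega>))\<^sup>2 + (norm (w (t + j) \<omega>))\<^sup>2)"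
        using p(1) by (simp add: mult.assoc mult_left_mono)
      with p(2)[of "?x t \<omega>"] show "?x t \<omega> \<bullet> (P *v ?x t \<omega>) \<le> p * c0 * (\<Sum>j<?n. (norm (?z (t + j) \<omega>))\<^sup>2 + (norm (w (t + j) \<omega>))\<^sup>2)"
        by linarith
    qed
    also have "\<dots> = p * c0 * (\<Sum>j<?n. stage_cost \<mu> (t + j) + trace W)"
      using int intw by (simp add: Bochner_Integration.integral_sum stage_cost_def noise_power)
    also have "\<dots> = p * c0 * (\<Sum>j<?n. stage_cost \<mu> (t + j)) + p * c0 * (real ?n * trace W)"
      by (simp add: sum.distrib distrib_left)
    also have "p * c0 * (\<Sum>j<?n. stage_cost \<mu> (t + j)) \<le> max 1 (p * c0) * (\<Sum>j<?n. stage_cost \<mu> (t + j))"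
      by (intro mult_right_mono sum_nonneg stage_cost_nonneg) auto
    finally show ?thesis by simp
  qed
  moreover have "max 1 (p * c0) \<ge> 1" by simp
  ultimately show thesis using that by blast
qed

text \<open>The accumulated terms of \<open>stage_cost_step\<close> that no policy can
  influence.\<close>

definition running_bound :: "nat \<Rightarrow> real" where
  "running_bound T = (\<Sum>t<T. trace (Z ** noise_gramian A W (age t)) + trace (P ** W))"

lemma running_bound_asymptotics:
  obtains C where "\<And>T. \<bar>running_bound T - real T * optimal_value\<bar> \<le> C"
proof -
  let ?f = "\<lambda>k. trace (Z ** noise_gramian A W k)"
  obtain C where C: "\<And>T. \<bar>(\<Sum>t<T. ?f (age t)) - real T * ((\<Sum>l<length \<tau>. \<Sum>k<\<tau> ! l. ?f k) / real (sum_list \<tau>))\<bar> \<le> C"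
    using sum_age_asymptotics[of ?f] by blast
  have "(\<Sum>l<length \<tau>. interval_cost A W Z (\<tau> ! l)) = (\<Sum>l<length \<tau>. \<Sum>k<\<tau> ! l. ?f k)"
    using positive by (intro sum.cong refl interval_cost_eq_sum) auto
  then have "running_bound T - real T * optimal_value
      = (\<Sum>t<T. ?f (age t)) - real T * ((\<Sum>l<length \<tau>. \<Sum>k<\<tau> ! l. ?f k) / real (sum_list \<tau>))" for T
    by (simp add: running_bound_def optimal_value_def sum.distrib distrib_left)
  with C show thesis using that by metis
qed

text \<open>Summing \<open>stage_cost_step\<close> telescopes the values; the deviation terms and
  the initial value are nonnegative and are dropped.\<close>

lemma cost_lower_bound:
  assumes "control_policy \<tau> \<mu>" "admissible \<mu> T"
  shows "running_bound T \<le> (\<Sum>t<T. stage_cost \<mu> t) + value_at \<mu> T"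
  using assms(2)
proof (induction T)
  case 0
  then show ?case by (simp add: running_bound_def value_at_nonneg)
next
  case (Suc T)
  have "0 \<le> expectation (\<lambda>\<omega>. input_deviation \<mu> (noise \<omega>) T \<bullet> (S *v input_deviation \<mu> (noise \<omega>) T))"
    by (simp add: S_nonneg)
  with stage_cost_step[OF assms(1), of T] Suc show ?case
    by (simp add: running_bound_def)
qed

section \<open>The certainty-equivalent policy attains the value\<close>

abbreviation optimal_feedback :: "nat \<Rightarrow> (nat \<Rightarrow> real ^ 'n) \<Rightarrow> real ^ 'm" where
  "optimal_feedback \<equiv> estimate_feedback A B K \<tau>"

lemma control_policy_optimal_feedback: "control_policy \<tau> optimal_feedback"
proof -
  \<comment> \<open>The recursion goes back to earlier times while the data remain those of time
    \<open>t\<close>, hence the separate index \<open>k\<close>.\<close>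
  have "(\<lambda>y. filtered_state A B K \<tau> y k) \<in> borel_measurable (Pi\<^sub>M (known_times \<tau> t) (\<lambda>_. borel))"
    if "k \<le> t" for k t
    using that
  proof (induction k)
    case 0
    then show ?case by (auto simp: sampled_0 known_times_def intro!: measurable_component_singleton)
  next
    case (Suc k)
    show ?case
    proof (cases "sampled \<tau> (Suc k)")
      case True
      then show ?thesis using Suc.prems by (auto simp: known_times_def intro!: measurable_component_singleton)
    next
      case False
      have "(\<lambda>y. A *v filtered_state A B K \<tau> y k + B *v (K *v filtered_state A B K \<tau> y k))
          \<in> borel_measurable (Pi\<^sub>M (known_times \<tau> t) (\<lambda>_. borel))"
        using Suc by (intro borel_measurable_add measurable_compose[OF _ borel_measurable_mult_vec]) auto
      then show ?thesis using False
        by (subst filtered_state.simps) (simp del: filtered_state.simps)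
    qed
  qed
  then show ?thesis
    unfolding control_policy_def estimate_feedback_def
    by (intro allI measurable_compose[OF _ borel_measurable_mult_vec]) auto
qed

text \<open>The actual input at \<open>k\<close> was computed from the data of time
  \<open>k\<close>, the recursion here from those of \<open>t\<close>. The induction hypothesis is
  used for both, so \<open>t\<close> is arbitrary.\<close>

lemma filtered_state_optimal_feedback:
  "k \<le> t \<Longrightarrow> filtered_state A B K \<tau> (\<lambda>r\<in>known_times \<tau> t. state A B x0 \<tau> optimal_feedback v r) k
     = state A B x0 \<tau> optimal_feedback v k - estimation_error v k"
proof (induction k arbitrary: t)
  case 0
  then show ?case by (simp add: sampled_0 known_times_def)
next
  case (Suc k)
  show ?case
  proof (cases "sampled \<tau> (Suc k)")
    case True
    then show ?thesis using Suc.prems by (simp add: known_times_def del: state.simps)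
  next
    case False
    have "control_input A B x0 \<tau> optimal_feedback v k
        = K *v (state A B x0 \<tau> optimal_feedback v k - estimation_error v k)"
      unfolding control_input_def estimate_feedback_def[of A B K \<tau> k]
      by (simp only: Suc.IH[OF order_refl])
    moreover have "filtered_state A B K \<tau> (\<lambda>r\<in>known_times \<tau> t. state A B x0 \<tau> optimal_feedback v r) k
        = state A B x0 \<tau> optimal_feedback v k - estimation_error v k"
      using Suc.prems by (intro Suc.IH) simp
    ultimately show ?thesis using False
      by (subst filtered_state.simps)
        (simp add: state_Suc matrix_vector_mult_diff_distrib del: filtered_state.simps state.simps)
  qed
qed

lemma optimal_feedback_input:
  "control_input A B x0 \<tau> optimal_feedback v t
     = K *v (state A B x0 \<tau> optimal_feedback v t - estimation_error v t)"
  unfolding control_input_def estimate_feedback_def[of A B K \<tau> t]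
  by (simp only: filtered_state_optimal_feedback[OF order_refl])

lemma admissible_optimal_feedback: "admissible optimal_feedback T"
proof -
  have "square_integrable M (\<lambda>\<omega>. control_input A B x0 \<tau> optimal_feedback (noise \<omega>) i)" for i
  proof (induction i rule: less_induct)
    case (less i)
    show ?case unfolding optimal_feedback_input
      by (intro square_integrable_intros state_square_integrable estimation_error_square_integrable less)
  qed
  then show ?thesis by blast
qed

text \<open>Here the input deviation vanishes identically, so the telescoped identity holds with
  equality.\<close>

lemma optimal_feedback_cost:
  "(\<Sum>t<T. stage_cost optimal_feedback t) + value_at optimal_feedback T
     = value_at optimal_feedback 0 + running_bound T"
proof (induction T)
  case (Suc T)
  have "input_deviation optimal_feedback v T = 0" for v
    by (simp add: input_deviation_def optimal_feedback_input)
  moreover have "square_integrable M (\<lambda>\<omega>. control_input A B x0 \<tau> optimal_feedback (noise \<omega>) i)"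
    if "i \<le> T" for i
    using that admissible_optimal_feedback[of "Suc T"] by auto
  note stage_cost_step[of optimal_feedback T, OF control_policy_optimal_feedback this]
  ultimately show ?case using Suc by (simp add: running_bound_def)
qed (simp add: running_bound_def)

lemma value_at_optimal_feedback_bounded:
  obtains b where "\<And>t. value_at optimal_feedback t \<le> b"
proof -
  let ?n = "CARD('n)" and ?V = "value_at optimal_feedback"
  obtain C where C: "\<And>T. \<bar>running_bound T - real T * optimal_value\<bar> \<le> C"
    using running_bound_asymptotics by blast
  obtain c d where cd: "c \<ge> 1" "\<And>t. ?V t \<le> c * (\<Sum>j<?n. stage_cost optimal_feedback (t + j)) + d"
    using value_at_window admissible_optimal_feedback by metis
  \<comment> \<open>Over a window the value grows by the running bound and drops by the cost paid,
    and that cost is at least \<open>(?V t - d) / c\<close>.\<close>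
  have "?V (t + ?n) \<le> (1 - 1 / c) * ?V t + (d / c + real ?n * optimal_value + 2 * C)" for t
  proof -
    let ?s = "\<Sum>j<?n. stage_cost optimal_feedback (t + j)"
    have "?V (t + ?n) = ?V t + (running_bound (t + ?n) - running_bound t) - ?s"
      using optimal_feedback_cost[of "t + ?n"] optimal_feedback_cost[of t]
      by (simp add: sum_lessThan_add)
    moreover have "running_bound (t + ?n) - running_bound t \<le> real ?n * optimal_value + 2 * C"
      using C[of t] C[of "t + ?n"] by (simp add: distrib_right abs_le_iff)
    moreover have "?V t / c - d / c \<le> ?s"
      using cd(2)[of t] cd(1) by (simp add: field_simps)
    ultimately show ?thesis by (simp add: left_diff_distrib)
  qed
  then show thesis
    using cd(1) by (intro bounded_by_contraction[of ?n "1 - 1 / c" ?V, OF _ _ _ _ that]) auto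
qed

lemma optimal_feedback_average_cost:
  "average_cost M w A B C2 D21 x0 \<tau> optimal_feedback \<longlonglongrightarrow> ereal optimal_value"
proof -
  let ?F = "\<lambda>T. \<Sum>t<T. stage_cost optimal_feedback t"
  obtain C where C: "\<And>T. \<bar>running_bound T - real T * optimal_value\<bar> \<le> C"
    using running_bound_asymptotics by blast
  obtain b where b: "\<And>t. value_at optimal_feedback t \<le> b"
    using value_at_optimal_feedback_bounded by blast
  \<comment> \<open>\<open>C\<close> covers the running bound; the initial and terminal values lie
    between 0 and \<open>b\<close>, so their difference costs at most \<open>b\<close>.\<close>
  define D where "D = C + b"
  have D: "\<bar>?F T - real T * optimal_value\<bar> \<le> D" for T
    using optimal_feedback_cost[of T] C[of T] b[of T] b[of 0]
      value_at_nonneg[of optimal_feedback T] value_at_nonneg[of optimal_feedback 0]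
    by (simp add: D_def abs_le_iff)
  have "(\<lambda>T. ?F T / real T - optimal_value) \<longlonglongrightarrow> 0"
  proof (rule Lim_null_comparison)
    show "\<forall>\<^sub>F T in sequentially. norm (?F T / real T - optimal_value) \<le> D / real T"
    proof (rule eventually_sequentiallyI[of 1])
      fix T :: nat assume "1 \<le> T"
      then have "?F T / real T - optimal_value = (?F T - real T * optimal_value) / real T"
        by (simp add: field_simps)
      then show "norm (?F T / real T - optimal_value) \<le> D / real T"
        using D[of T] by (simp add: divide_right_mono)
    qed
    show "(\<lambda>T. D / real T) \<longlonglongrightarrow> 0" by (rule lim_const_over_n)
  qed
  then have "(\<lambda>T. ereal (?F T / real T)) \<longlonglongrightarrow> ereal optimal_value"
    using LIM_zero_cancel by auto
  moreover have "\<forall>\<^sub>F T in sequentially. ereal (?F T / real T) = average_cost M w A B C2 D21 x0 \<tau> optimal_feedback T"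
    by (rule eventually_sequentiallyI[of 1]) (simp add: average_cost_eq[OF admissible_optimal_feedback])
  ultimately show ?thesis by (rule Lim_transform_eventually)
qed

text \<open>For a fixed number \<open>N\<close> of averaged horizons, letting \<open>T\<close> tend
  to infinity gives the bound up to the factor \<open>real N / (real N + k)\<close>; then
  \<open>N\<close> tends to infinity.\<close>

lemma average_cost_lower_bound:
  assumes pol: "control_policy \<tau> \<mu>"
  shows "ereal optimal_value \<le> liminf (average_cost M w A B C2 D21 x0 \<tau> \<mu>)"
proof -
  let ?n = "CARD('n)" and ?F = "\<lambda>T. \<Sum>t<T. stage_cost \<mu> t" and ?J = optimal_value
  let ?avg = "average_cost M w A B C2 D21 x0 \<tau> \<mu>"
  obtain C where C: "\<And>T. \<bar>running_bound T - real T * ?J\<bar> \<le> C"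
    using running_bound_asymptotics by blast
  obtain c d where cd: "c \<ge> 1" "\<And>t. admissible \<mu> (t + ?n) \<Longrightarrow>
       value_at \<mu> t \<le> c * (\<Sum>j<?n. stage_cost \<mu> (t + j)) + d"
    using value_at_window by metis
  define k where "k = c * real ?n"
  have k: "k > 0" using cd(1) by (simp add: k_def)
  have F_mono: "?F s \<le> ?F t" if "s \<le> t" for s t
    using that by (intro sum_mono2) (auto simp: stage_cost_nonneg)
  have F_shift: "(\<Sum>i<N. stage_cost \<mu> (s + i)) \<le> ?F t" if "s + N \<le> t" for s N t
  proof -
    have "(\<Sum>i<N. stage_cost \<mu> (s + i)) \<le> ?F (s + N)"
      unfolding sum_lessThan_add by (simp add: sum_nonneg stage_cost_nonneg)
    also have "\<dots> \<le> ?F t" using that by (rule F_mono)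
    finally show ?thesis .
  qed
  have bound: "real N * (real T * ?J - (real (?n + N) * \<bar>?J\<bar> + C + d)) \<le> (real N + k) * ?F T"
    if adm: "admissible \<mu> T" and T: "?n + N \<le> T" for N T
  proof -
    \<comment> \<open>The terminal term may be large at \<open>T\<close>, but by observability its sum over \<open>N\<close> earlier times
      is at most a fixed multiple of the total cost.\<close>
    define m where "m = T - ?n - N"
    have m: "T = m + N + ?n" using T by (simp add: m_def)
    have "real T * ?J - (real (?n + N) * \<bar>?J\<bar> + C + d) \<le> ?F T + c * (\<Sum>j<?n. stage_cost \<mu> (m + i + j))"
      if i: "i < N" for i
    proof -
      have adm': "admissible \<mu> (m + i)" "admissible \<mu> (m + i + ?n)" using adm m i by auto
      have "real (m + i) * ?J - C \<le> running_bound (m + i)"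
        using C[of "m + i"] by (simp add: abs_le_iff)
      also have "\<dots> \<le> ?F (m + i) + value_at \<mu> (m + i)"
        by (rule cost_lower_bound[OF pol adm'(1)])
      also have "\<dots> \<le> ?F T + (c * (\<Sum>j<?n. stage_cost \<mu> (m + i + j)) + d)"
        using m i by (intro add_mono F_mono cd(2) adm'(2)) simp
      finally have "real (m + i) * ?J - C - d \<le> ?F T + c * (\<Sum>j<?n. stage_cost \<mu> (m + i + j))" by simp
      \<comment> \<open>Stopping before \<open>T\<close> loses at most \<open>?n + N\<close> steps;
        the absolute value covers either sign of \<open>?J\<close>.\<close>
      moreover have "real T * ?J - real (?n + N) * \<bar>?J\<bar> \<le> real (m + i) * ?J"
      proof -
        have "real T * ?J - real (m + i) * ?J = real (?n + N - i) * ?J"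
          using m i by (simp add: of_nat_diff algebra_simps)
        also have "\<dots> \<le> real (?n + N - i) * \<bar>?J\<bar>" by (intro mult_left_mono) auto
        also have "\<dots> \<le> real (?n + N) * \<bar>?J\<bar>" by (intro mult_right_mono) auto
        finally show ?thesis by simp
      qed
      ultimately show ?thesis by simp
    qed
    then have "(\<Sum>i<N. real T * ?J - (real (?n + N) * \<bar>?J\<bar> + C + d))
        \<le> (\<Sum>i<N. ?F T + c * (\<Sum>j<?n. stage_cost \<mu> (m + i + j)))"
      by (intro sum_mono) auto
    \<comment> \<open>After the swap, each offset \<open>j\<close> carries the costs of
      \<open>N\<close> consecutive times, together at most \<open>?F T\<close>. The values thus add
      the factor \<open>c * real ?n\<close>, free of \<open>N\<close>, to the factor
      \<open>real N\<close> of the costs.\<close>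
    also have "\<dots> = real N * ?F T + c * (\<Sum>j<?n. \<Sum>i<N. stage_cost \<mu> (m + j + i))"
      by (subst sum.swap) (simp add: sum.distrib sum_distrib_left[symmetric] add_ac)
    also have "(\<Sum>j<?n. \<Sum>i<N. stage_cost \<mu> (m + j + i)) \<le> (\<Sum>j<?n. ?F T)"
      using m by (intro sum_mono F_shift) auto
    finally show ?thesis using cd(1) by (simp add: k_def algebra_simps)
  qed
  have scaled: "ereal (real N / (real N + k) * ?J) \<le> liminf ?avg" for N
  proof -
    \<comment> \<open>Independent of \<open>T\<close>, so its share vanishes in the average.\<close>
    define E where "E = real (?n + N) * \<bar>?J\<bar> + C + d"
    let ?g = "\<lambda>T. real N / (real N + k) * (?J - E / real T)"
    have lim: "(\<lambda>T. ereal (?g T)) \<longlonglongrightarrow> ereal (real N / (real N + k) * (?J - 0))"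
      by (intro tendsto_ereal tendsto_mult tendsto_diff tendsto_const lim_const_over_n)
    have "ereal (real N / (real N + k) * ?J) = liminf (\<lambda>T. ereal (?g T))"
      using lim_imp_Liminf[OF sequentially_bot lim] by (simp only: diff_0_right)
    also have "\<dots> \<le> liminf ?avg"
    proof (rule Liminf_mono, rule eventually_sequentiallyI[of "Suc (?n + N)"])
      fix T assume T: "Suc (?n + N) \<le> T"
      show "ereal (?g T) \<le> ?avg T"
      \<comment> \<open>An infinite average makes the inequality trivial; a finite one makes the
        inputs before \<open>T\<close> square integrable.\<close>
      proof (cases "?avg T = \<infinity>")
        case False
        then have adm: "admissible \<mu> T" using T by (intro finite_cost_admissible[OF pol]) auto
        have "real N * (real T * ?J - E) \<le> (real N + k) * ?F T"
          unfolding E_def using T by (intro bound[OF adm]) simp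
        then have "real N * (real T * ?J - E) / ((real N + k) * real T) \<le> (real N + k) * ?F T / ((real N + k) * real T)"
          using k by (intro divide_right_mono) auto
        also have "real N * (real T * ?J - E) / ((real N + k) * real T) = ?g T"
          using T k by (simp add: field_simps)
        also have "(real N + k) * ?F T / ((real N + k) * real T) = ?F T / real T"
          using k by simp
        finally show ?thesis using T by (simp add: average_cost_eq[OF adm])
      qed simp
    qed
    finally show ?thesis .
  qed
  have "(\<lambda>N. ereal (real N / (real N + k) * ?J)) \<longlonglongrightarrow> ereal (1 * ?J)"
  proof (intro tendsto_ereal tendsto_mult tendsto_const)
    show "(\<lambda>N. real N / (real N + k)) \<longlonglongrightarrow> 1" by real_asymp
  qed
  then have "ereal (1 * ?J) \<le> liminf ?avg"
    by (rule LIMSEQ_le_const2) (use scaled in blast)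
  then show ?thesis by simp
qed

end

theorem proposition1:
  fixes M :: "'a measure"
    and w :: "nat \<Rightarrow> 'a \<Rightarrow> real ^ 'n"
    and A W P Q Z :: "real ^ 'n ^ 'n"
    and B :: "real ^ 'm ^ 'n"
    and C2 :: "real ^ 'n ^ 'p"
    and D21 :: "real ^ 'm ^ 'p"
    and R :: "real ^ 'm ^ 'm"
    and K :: "real ^ 'n ^ 'm"
    and x0 :: "real ^ 'n"
    and \<tau> :: "nat list"
  assumes "transpose C2 ** D21 = 0"
    and "Q = transpose C2 ** C2"
    and "R = transpose D21 ** D21"
    and "pos_def R"
    and "controllable A B"
    and "observable A C2"
    and "prob_space M"
    and "prob_space.indep_vars M (\<lambda>_. borel) w UNIV"
    and "\<And>t. distr M borel (w t) = distr M borel (w 0)"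
    and "\<And>t. has_bochner_integral M (w t) 0"
    and "\<And>t. has_bochner_integral M (\<lambda>\<omega>. \<chi> i j. w t \<omega> $ i * w t \<omega> $ j) W"
    and "pos_semidef W"
    and "pos_def P"
    and "riccati_solution A B Q R P"
    and "Z = transpose A ** P ** B ** matrix_inv (transpose B ** P ** B + R) ** transpose B ** P ** A"
    and "K = - (matrix_inv (transpose B ** P ** B + R) ** transpose B ** P ** A)"
    and "\<tau> \<noteq> []"
    and "\<forall>p\<in>set \<tau>. p > 0"
  shows "optimal_policy M w A B C2 D21 x0 \<tau> (estimate_feedback A B K \<tau>)
    (trace (P ** W) + (\<Sum>l<length \<tau>. interval_cost A W Z (\<tau> ! l)) / real (sum_list \<tau>))"
proof -
  interpret prob_space M by fact
  interpret lq_system A P Q Z B C2 D21 R "transpose B ** P ** B + R" K \<tau> M w W x0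
    by unfold_locales (use assms in \<open>simp_all\<close>)
  show ?thesis
    unfolding optimal_policy_def optimal_value_def[symmetric]
    using control_policy_optimal_feedback optimal_feedback_average_cost average_cost_lower_bound by blast
qed

end
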